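(* Let $k$ be a prime number, let $m,n$ be positive integers, and let $\mathcal{F}=\{f_1,\dots,f_n\}$ be a family of $n$ functions $f_i:\{0,1\}^m\to\mathbb{R}$, each of which is $1$-Lipschitz. Then $$\operatorname{disc}(\mathcal{F},k) < \sqrt{2n(k-1)\cdot\left(1+\ln(nk)\right)}.$$
   Context: Write $[r]=\{1,\dots,r\}$. A subset $S\subseteq[m]$ is identified with its indicator vector in $\{0,1\}^m$, so a function $f:\{0,1\}^m\to\mathbb{R}$ is a real-valued set function on subsets of $[m]$. No additivity, monotonicity or sign condition is assumed. For $S,T\subseteq[m]$, $d(S,T)$ denotes the Hamming distance. A function $f:\{0,1\}^m\to\mathbb{R}$ is $1$-Lipschitz if $|f(S)-f(S')|\le 1$ for all $S,S'\subseteq[m]$ with $d(S,S')\le 1$. A $k$-coloring of $[m]$ is a function $\chi:[m]\to[k]$. Its discrepancy with respect to $\mathcal{F}=\{f_1,\dots,f_n\}$ is $$\operatorname{disc}(\mathcal{F},\chi):=\max_{i\in[n]}\ \max_{j,\ell\in[k]}\ |f_i(\chi^{-1}(j))-f_i(\chi^{-1}(\ell))|,$$ and the $k$-color discrepancy of $\mathcal{F}$ is $$\operatorname{disc}(\mathcal{F},k):=\min_{\chi:[m]\to[k]}\operatorname{disc}(\mathcal{F},\chi).$$ *)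

theory Defs
  imports Complex_Main "HOL-Library.FuncSet" "HOL-Computational_Algebra.Primes"
begin

definition hamming_dist :: "'a set \<Rightarrow> 'a set \<Rightarrow> nat" where
  "hamming_dist S T = card ((S - T) \<union> (T - S))"

text \<open>A function on \<open>{0,1}\<^sup>m\<close> is rendered as a function on \<open>nat set\<close>, of which only the
  values at subsets of \<open>{1..m}\<close> are ever used.\<close>

definition one_lipschitz :: "nat \<Rightarrow> (nat set \<Rightarrow> real) \<Rightarrow> bool" where
  "one_lipschitz m f \<longleftrightarrow>
     (\<forall>S S'. S \<subseteq> {1..m} \<longrightarrow> S' \<subseteq> {1..m} \<longrightarrow> hamming_dist S S' \<le> 1 \<longrightarrow> \<bar>f S - f S'\<bar> \<le> 1)"

definition colorings :: "nat \<Rightarrow> nat \<Rightarrow> (nat \<Rightarrow> nat) set" where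
  "colorings m k = {1..m} \<rightarrow>\<^sub>E {1..k}"

definition color_class :: "nat \<Rightarrow> (nat \<Rightarrow> nat) \<Rightarrow> nat \<Rightarrow> nat set" where
  "color_class m \<chi> j = {x \<in> {1..m}. \<chi> x = j}"

text \<open>The maxima and the minimum below are over finite sets, which are nonempty for \<open>n, k \<ge> 1\<close>.\<close>

definition coloring_disc ::
  "nat \<Rightarrow> nat \<Rightarrow> (nat \<Rightarrow> nat set \<Rightarrow> real) \<Rightarrow> nat \<Rightarrow> (nat \<Rightarrow> nat) \<Rightarrow> real" where
  "coloring_disc m n f k \<chi> =
     (MAX i\<in>{1..n}. MAX (j, l)\<in>{1..k} \<times> {1..k}.
        \<bar>f i (color_class m \<chi> j) - f i (color_class m \<chi> l)\<bar>)"

definition disc :: "nat \<Rightarrow> nat \<Rightarrow> (nat \<Rightarrow> nat set \<Rightarrow> real) \<Rightarrow> nat \<Rightarrow> real" where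
  "disc m n f k = (MIN \<chi>\<in>colorings m k. coloring_disc m n f k \<chi>)"

end

theory Submission
  imports Defs "HOL-Number_Theory.Cong" "HOL-Probability.Hoeffding"
begin

text \<open>
  Put the elements on a line, divide each of them into \<open>R\<close> pieces and color the pieces (a word). Let
  each element pick the color of a random piece, and let \<open>N = n (k - 1)\<close>. It suffices to find a word
  with at most \<open>N\<close> color changes for which the expected values of each \<open>f\<^sub>i\<close> on the \<open>k\<close> color classes
  almost agree: at most \<open>N\<close> elements are then random, and McDiarmid's inequality with a union bound
  over the \<open>n k\<close> values and both signs rounds the word with deviations slightly above
  \<open>sqrt (N ln (2 n k) / 2)\<close>. The strictness comes from \<open>ln 2 < 1\<close>.

  Such a word exists by a \<open>\<int>/k\<close>-equivariant argument. If there were none, label each word by some \<open>i\<close>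
  whose expected values are far apart and by a color maximizing them. This labeling is equivariant, and
  by the Lipschitz property no set of nearby words carries all colors for the same \<open>i\<close>. Overwriting
  longer and longer prefixes by one color contracts the space of words and creates at most one new
  color change; hence the \<open>\<int>/k\<close>-equivariant chains obtained by repeated contraction consist in dimension
  \<open>d\<close> of nearby words with at most \<open>d\<close> color changes. The complex of label sets without a full group of
  \<open>k\<close> colors carries a free action and has no simplices with \<open>N + 1\<close> vertices, while the degree of the
  labeling, computed with an explicit dual family of cochains, is \<open>1\<close> modulo \<open>k\<close> in every dimension up
  to \<open>N\<close>.
\<close>

section \<open>Chains obtained by repeated contraction\<close>

text \<open>Cochains are arbitrary functions on ordered lists of vertices; \<open>cobd x \<alpha>\<close> is the value of the
  coboundary of \<open>\<alpha>\<close> at \<open>x\<close>, that is, \<open>\<alpha>\<close> evaluated on the alternating sum of the faces of \<open>x\<close>.\<close>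

primrec cobd :: "'a list \<Rightarrow> ('a list \<Rightarrow> int) \<Rightarrow> int" where
  "cobd [] \<alpha> = 0"
| "cobd (a # x) \<alpha> = \<alpha> x - cobd x (\<lambda>y. \<alpha> (a # y))"

lemma cobd_cong:
  assumes "\<And>y. set y \<subseteq> set x \<Longrightarrow> Suc (length y) = length x \<Longrightarrow> \<alpha> y = \<beta> y"
  shows "cobd x \<alpha> = cobd x \<beta>"
  using assms
proof (induction x arbitrary: \<alpha> \<beta>)
  case (Cons a x)
  have "cobd x (\<lambda>y. \<alpha> (a # y)) = cobd x (\<lambda>y. \<beta> (a # y))"
    by (intro Cons.IH Cons.prems) auto
  moreover have "\<alpha> x = \<beta> x" by (rule Cons.prems) auto
  ultimately show ?case by simp
qed simp

lemma cobd_diff: "cobd x (\<lambda>y. \<alpha> y - \<beta> y) = cobd x \<alpha> - cobd x \<beta>"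
  by (induction x arbitrary: \<alpha> \<beta>) auto

lemma cobd_zero [simp]: "cobd x (\<lambda>y. 0) = 0"
  by (induction x) auto

lemma cobd_add: "cobd x (\<lambda>y. \<alpha> y + \<beta> y) = cobd x \<alpha> + cobd x \<beta>"
  by (induction x arbitrary: \<alpha> \<beta>) auto

lemma cobd_uminus: "cobd x (\<lambda>y. - \<alpha> y) = - cobd x \<alpha>"
  using cobd_diff[of x "\<lambda>_. 0" \<alpha>] by simp

lemma cobd_sum: "cobd x (\<lambda>y. \<Sum>g\<in>A. \<alpha> g y) = (\<Sum>g\<in>A. cobd x (\<alpha> g))"
  by (induction A rule: infinite_finite_induct) (auto simp: cobd_add)

lemma cobd_map: "cobd (map f x) \<alpha> = cobd x (\<lambda>y. \<alpha> (map f y))"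
  by (induction x arbitrary: \<alpha>) auto

lemma cobd_cobd: "cobd x (\<lambda>y. cobd y \<alpha>) = 0"
  by (induction x arbitrary: \<alpha>) (auto simp: cobd_diff)

section \<open>Normalized and alternating cochains\<close>

definition normalized :: "('a list \<Rightarrow> int) \<Rightarrow> bool" where
  "normalized \<alpha> \<longleftrightarrow> (\<forall>u a w. \<alpha> (u @ a # a # w) = 0)"

definition alternating :: "('a list \<Rightarrow> int) \<Rightarrow> bool" where
  "alternating \<alpha> \<longleftrightarrow>
     normalized \<alpha> \<and> (\<forall>u a b w. \<alpha> (u @ a # b # w) = - \<alpha> (u @ b # a # w))"

lemma normalized_map: "normalized \<alpha> \<Longrightarrow> normalized (\<lambda>x. \<alpha> (map f x))"
  by (auto simp: normalized_def)

lemma alternating_swap: "alternating \<alpha> \<Longrightarrow> \<alpha> (u @ a # b # w) = - \<alpha> (u @ b # a # w)"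
  unfolding alternating_def by blast

lemma alternating_repeat: "alternating \<alpha> \<Longrightarrow> \<alpha> (u @ a # a # w) = 0"
  unfolding alternating_def normalized_def by blast

lemma alternatingI:
  assumes "\<And>u a w. \<alpha> (u @ a # a # w) = 0"
    and "\<And>u a b w. \<alpha> (u @ a # b # w) = - \<alpha> (u @ b # a # w)"
  shows "alternating \<alpha>"
  using assms unfolding alternating_def normalized_def by blast

text \<open>Adjacent swaps, each costing only a sign, carry one copy of the repeated entry next to
  the other.\<close>

lemma alternating_not_distinct:
  assumes "alternating \<alpha>" "\<not> distinct x"
  shows "\<alpha> x = 0"
proof -
  have *: "\<alpha> (u @ a # m @ a # w) = 0" for u a m w
  proof (induction m arbitrary: u)
    case Nil
    show ?case using alternating_repeat[OF assms(1), of u a w] by simp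
  next
    case (Cons c m)
    have "\<alpha> (u @ a # c # m @ a # w) = - \<alpha> ((u @ [c]) @ a # m @ a # w)"
      using alternating_swap[OF assms(1), of u a c "m @ a # w"] by simp
    then show ?case using Cons[of "u @ [c]"] by simp
  qed
  show ?thesis using not_distinct_decomp[OF assms(2)] * by auto
qed

lemma alternating_Cons:
  assumes "alternating \<alpha>"
  shows "alternating (\<lambda>y. \<alpha> (c # y))"
proof (rule alternatingI)
  show "\<alpha> (c # u @ a # a # w) = 0" for u a w
    using alternating_repeat[OF assms, of "c # u" a w] by simp
  show "\<alpha> (c # u @ a # b # w) = - \<alpha> (c # u @ b # a # w)" for u a b w
    using alternating_swap[OF assms, of "c # u" a b w] by simp
qed

text \<open>The two faces that drop one entry of the swapped pair exchange roles with opposite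
  signs; every other face inherits the sign change from \<alpha>.\<close>

lemma alternating_cobd:
  assumes "alternating \<alpha>"
  shows "alternating (\<lambda>x. cobd x \<alpha>)"
proof -
  have "cobd (u @ a # b # w) \<alpha> = - cobd (u @ b # a # w) \<alpha>" for u a b w
    using assms
  proof (induction u arbitrary: \<alpha>)
    case Nil
    have "cobd w (\<lambda>y. \<alpha> (a # b # y)) = - cobd w (\<lambda>y. \<alpha> (b # a # y))"
      using alternating_swap[OF Nil, of "[]" a b] by (simp flip: cobd_uminus)
    then show ?case by simp
  next
    case (Cons c u)
    show ?case using Cons.IH[OF alternating_Cons[OF Cons.prems, of c]] alternating_swap[OF Cons.prems, of u a b w]
      by simp
  qed
  moreover have "cobd (u @ a # a # w) \<alpha> = 0" for u a w
    using assms
  proof (induction u arbitrary: \<alpha>)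
    case Nil
    then show ?case using alternating_repeat[OF Nil, of "[]"] by simp
  next
    case (Cons c u)
    show ?case using Cons.IH[OF alternating_Cons[OF Cons.prems, of c]] alternating_repeat[OF Cons.prems, of u a w]
      by simp
  qed
  ultimately show ?thesis by (intro alternatingI)
qed

section \<open>Prisms as cochain homotopies\<close>

text \<open>The value of \<open>\<alpha>\<close> on the prism over \<open>x\<close> between \<open>map h x\<close> and \<open>map h' x\<close>, i.e. the alternating sum
  over \<open>i\<close> of the lists \<open>[h x\<^sub>0, \<dots>, h x\<^sub>i, h' x\<^sub>i, \<dots>, h' x\<^sub>d]\<close>.\<close>

primrec prism :: "('a \<Rightarrow> 'b) \<Rightarrow> ('a \<Rightarrow> 'b) \<Rightarrow> 'a list \<Rightarrow> ('b list \<Rightarrow> int) \<Rightarrow> int" where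
  "prism h h' [] \<alpha> = 0"
| "prism h h' (a # x) \<alpha> = \<alpha> (h a # map h' (a # x)) - prism h h' x (\<lambda>y. \<alpha> (h a # y))"

lemma prism_diff: "prism h h' x (\<lambda>y. \<alpha> y - \<beta> y) = prism h h' x \<alpha> - prism h h' x \<beta>"
  by (induction x arbitrary: \<alpha> \<beta>) auto

lemma prism_zero [simp]: "prism h h' x (\<lambda>y. 0) = 0"
  by (induction x) auto

text \<open>The prism operator is a cochain homotopy between the pullbacks along \<open>h\<close>
  and \<open>h'\<close>; summed over the steps of a sweep it becomes a contraction.\<close>

lemma prism_cobd:
  "prism h h' x (\<lambda>y. cobd y \<alpha>) + cobd x (\<lambda>y. prism h h' y \<alpha>) = \<alpha> (map h' x) - \<alpha> (map h x)"
proof (induction x arbitrary: \<alpha>)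
  case (Cons a z)
  show ?case using Cons[of "\<lambda>y. \<alpha> (h a # y)"]
    by (simp add: prism_diff cobd_diff cobd_map)
qed simp

lemma prism_cong:
  assumes "\<And>i. i < length x \<Longrightarrow>
    \<alpha> (map h (take (Suc i) x) @ map h' (drop i x)) = \<beta> (map h (take (Suc i) x) @ map h' (drop i x))"
  shows "prism h h' x \<alpha> = prism h h' x \<beta>"
  using assms
proof (induction x arbitrary: \<alpha> \<beta>)
  case (Cons a x)
  have "prism h h' x (\<lambda>y. \<alpha> (h a # y)) = prism h h' x (\<lambda>y. \<beta> (h a # y))"
  proof (rule Cons.IH)
    fix i assume "i < length x"
    then show "\<alpha> (h a # map h (take (Suc i) x) @ map h' (drop i x)) =
      \<beta> (h a # map h (take (Suc i) x) @ map h' (drop i x))"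
      using Cons.prems[of "Suc i"] by simp
  qed
  with Cons.prems[of 0] show ?case by simp
qed simp

text \<open>A prism list that breaks at the first of two equal neighbors repeats its
  \<open>h'\<close> value, and one that breaks at the second repeats its \<open>h\<close> value. The
  property \<open>alternating\<close> need not survive \<open>prism\<close>, so the chains are
  treated with normalized cochains.\<close>

lemma normalized_prism:
  assumes "normalized \<alpha>"
  shows "normalized (\<lambda>x. prism h h' x \<alpha>)"
proof -
  have "prism h h' (u @ a # a # w) \<alpha> = 0" for u a w
    using assms
  proof (induction u arbitrary: \<alpha>)
    case Nil
    have "\<alpha> (h a # h' a # h' a # map h' w) = 0"
      using Nil unfolding normalized_def by (metis append_Cons append_Nil)
    moreover have "\<alpha> (h a # h a # y) = 0" for y
      using Nil unfolding normalized_def by (metis append_Nil)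
    ultimately show ?case by simp
  next
    case (Cons c u)
    have "normalized (\<lambda>y. \<alpha> (h c # y))"
      using Cons.prems unfolding normalized_def by (metis append_Cons)
    moreover have "\<alpha> (h c # h' c # map h' (u @ a # a # w)) = 0"
      using Cons.prems unfolding normalized_def by (metis append_Cons list.simps(9) map_append)
    ultimately show ?case using Cons.IH by simp
  qed
  then show ?thesis by (simp add: normalized_def)
qed

section \<open>Equivariant chains and their degree\<close>

text \<open>The maps \<open>h 0, \<dots>, h M\<close> form a discrete contraction of the vertex set to \<open>v0\<close>. They need not
  commute with \<open>t\<close>. The set \<open>G d\<close> contains the support of the chain that \<open>C d\<close> integrates over.\<close>

locale sweep =
  fixes t :: "'v \<Rightarrow> 'v" and p :: nat and h :: "nat \<Rightarrow> 'v \<Rightarrow> 'v" and M :: nat and v0 :: 'v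
    and G :: "nat \<Rightarrow> 'v list set"
  assumes h_0: "h 0 v = v" and h_M: "h M v = v0"
    and G_0: "[v0] \<in> G 0"
    and G_t: "x \<in> G d \<Longrightarrow> map t x \<in> G d"
    and G_h: "x \<in> G d \<Longrightarrow> s < M \<Longrightarrow> i \<le> d \<Longrightarrow>
      map (h (Suc s)) (take (Suc i) x) @ map (h s) (drop i x) \<in> G (Suc d)"
    and G_length: "x \<in> G d \<Longrightarrow> length x = Suc d"
    and G_period: "x \<in> G d \<Longrightarrow> v \<in> set x \<Longrightarrow> (t ^^ p) v = v"
begin

text \<open>Integration over the track of \<open>x\<close> under the contraction from the identity
  to the constant \<open>v0\<close>.\<close>

definition H :: "('v list \<Rightarrow> int) \<Rightarrow> 'v list \<Rightarrow> int" where
  "H \<alpha> x = (\<Sum>s<M. prism (h (Suc s)) (h s) x \<alpha>)"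

text \<open>The transposes of \<open>1 - t\<close> and of the norm element, the two alternating
  differentials of the periodic resolution of the cyclic group of order \<open>p\<close>.\<close>

definition rho :: "nat \<Rightarrow> ('v list \<Rightarrow> int) \<Rightarrow> 'v list \<Rightarrow> int" where
  "rho d \<alpha> x = (if even d then \<alpha> x - \<alpha> (map t x) else (\<Sum>g<p. \<alpha> (map (t ^^ g) x)))"

text \<open>\<open>C d\<close> is integration over a chain \<open>c\<^sub>d\<close> with \<open>c\<^sub>0 = [v0]\<close> and, up to degenerate lists,
  \<open>\<partial> c\<^sub>d\<^sub>+\<^sub>1 = (1 - t) c\<^sub>d\<close> for even \<open>d\<close> and \<open>\<partial> c\<^sub>d\<^sub>+\<^sub>1 = (1 + t + \<dots> + t\<^sup>p\<^sup>-\<^sup>1) c\<^sub>d\<close> for odd \<open>d\<close>.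
  Each \<open>c\<^sub>d\<^sub>+\<^sub>1\<close> is obtained by contracting the prescribed boundary.\<close>

primrec C :: "nat \<Rightarrow> ('v list \<Rightarrow> int) \<Rightarrow> int" where
  "C 0 \<alpha> = \<alpha> [v0]"
| "C (Suc d) \<alpha> = C d (rho d (H \<alpha>))"

lemma G_funpow: "x \<in> G d \<Longrightarrow> map (t ^^ g) x \<in> G d"
proof (induction g)
  case (Suc g)
  then show ?case using G_t[of "map (t ^^ g) x" d] by (simp add: comp_def)
qed simp

lemma rho_cong:
  assumes "x \<in> G d" "\<And>y. y \<in> G d \<Longrightarrow> \<alpha> y = \<beta> y"
  shows "rho e \<alpha> x = rho e \<beta> x"
  using assms G_t G_funpow by (auto simp: rho_def)

lemma H_cong:
  assumes "x \<in> G d" "\<And>y. y \<in> G (Suc d) \<Longrightarrow> \<alpha> y = \<beta> y"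
  shows "H \<alpha> x = H \<beta> x"
  unfolding H_def
  using assms G_h[OF assms(1)] G_length[OF assms(1)] by (intro sum.cong refl prism_cong) auto

text \<open>This is how the support \<open>G\<close> enters: identities between cochains are needed
  only on the lists in \<open>G d\<close>.\<close>

lemma C_cong:
  assumes "\<And>y. y \<in> G d \<Longrightarrow> \<alpha> y = \<beta> y"
  shows "C d \<alpha> = C d \<beta>"
  using assms
proof (induction d arbitrary: \<alpha> \<beta>)
  case 0
  then show ?case using G_0 by simp
next
  case (Suc d)
  show ?case unfolding C.simps
    by (rule Suc.IH, rule rho_cong, assumption, rule H_cong, assumption, rule Suc.prems)
qed

lemma H_diff: "H (\<lambda>y. \<alpha> y - \<beta> y) = (\<lambda>x. H \<alpha> x - H \<beta> x)"
  by (auto simp: H_def prism_diff sum_subtractf)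

lemma rho_diff: "rho d (\<lambda>y. \<alpha> y - \<beta> y) = (\<lambda>x. rho d \<alpha> x - rho d \<beta> x)"
  by (auto simp: rho_def sum_subtractf)

lemma C_diff: "C d (\<lambda>y. \<alpha> y - \<beta> y) = C d \<alpha> - C d \<beta>"
  by (induction d arbitrary: \<alpha> \<beta>) (auto simp: H_diff rho_diff)

lemma C_zero [simp]: "C d (\<lambda>y. 0) = 0"
  using C_diff[of d "\<lambda>_. 0" "\<lambda>_. 0"] by simp

lemma C_add: "C d (\<lambda>y. \<alpha> y + \<beta> y) = C d \<alpha> + C d \<beta>"
  using C_diff[of d \<alpha> "\<lambda>y. 0 - \<beta> y"] C_diff[of d "\<lambda>y. 0" \<beta>] by simp

lemma C_sum: "C d (\<lambda>y. \<Sum>g\<in>A. \<alpha> g y) = (\<Sum>g\<in>A. C d (\<alpha> g))"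
  by (induction A rule: infinite_finite_induct) (auto simp: C_add)

lemma rho_cobd: "rho d (\<lambda>y. cobd y \<alpha>) x = cobd x (rho d \<alpha>)"
  by (auto simp: rho_def[abs_def] cobd_diff cobd_sum cobd_map)

text \<open>Summing \<open>prism_cobd\<close> over the sweep telescopes from the identity
  \<open>h 0\<close> to the constant map \<open>h M\<close>.\<close>

lemma H_cobd: "H (\<lambda>y. cobd y \<alpha>) x = \<alpha> x - \<alpha> (map (\<lambda>_. v0) x) - cobd x (H \<alpha>)"
proof -
  have "H (\<lambda>y. cobd y \<alpha>) x + cobd x (H \<alpha>) =
      (\<Sum>s<M. prism (h (Suc s)) (h s) x (\<lambda>y. cobd y \<alpha>) +
        cobd x (\<lambda>y. prism (h (Suc s)) (h s) y \<alpha>))"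
    by (simp add: H_def[abs_def] cobd_sum sum.distrib)
  also have "\<dots> = (\<Sum>s<M. \<alpha> (map (h s) x) - \<alpha> (map (h (Suc s)) x))"
    by (simp add: prism_cobd)
  also have "\<dots> = \<alpha> (map (h 0) x) - \<alpha> (map (h M) x)"
    by (rule sum_lessThan_telescope')
  also have "\<dots> = \<alpha> x - \<alpha> (map (\<lambda>_. v0) x)"
  proof -
    have "h 0 = id" "h M = (\<lambda>_. v0)" using h_0 h_M by auto
    then show ?thesis by simp
  qed
  finally show ?thesis by simp
qed

text \<open>The product of \<open>1 - t\<close> and the norm element is zero: the sum telescopes and
  closes up because \<open>t\<close> has period \<open>p\<close> on the entries of lists in
  \<open>G d\<close>.\<close>

lemma rho_rho:
  assumes "x \<in> G d"
  shows "rho d (rho (Suc d) \<alpha>) x = 0"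
proof -
  have p: "map (t ^^ p) x = x"
    using G_period[OF assms] by (simp add: map_idI)
  have t1: "t \<circ> t ^^ g = t ^^ Suc g" "t ^^ g \<circ> t = t ^^ Suc g" for g
    by (simp, simp only: funpow_Suc_right)
  have "(\<Sum>g<p. \<alpha> (map (t ^^ g) x) - \<alpha> (map (t ^^ Suc g) x)) =
      \<alpha> (map (t ^^ 0) x) - \<alpha> (map (t ^^ p) x)"
    by (rule sum_lessThan_telescope')
  then have *: "(\<Sum>g<p. \<alpha> (map (t ^^ g) x) - \<alpha> (map (t ^^ Suc g) x)) = 0"
    by (simp add: p)
  show ?thesis
    using * by (auto simp: rho_def t1 sum_subtractf simp del: funpow.simps)
qed

lemma normalized_rho_H:
  assumes "normalized \<alpha>"
  shows "normalized (rho d (H \<alpha>))"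
proof -
  have "prism h h' (u @ a # a # w) \<alpha> = 0" for h h' :: "'v \<Rightarrow> 'v" and u a w
    using normalized_prism[OF assms, of h h'] unfolding normalized_def by blast
  then show ?thesis by (auto simp: rho_def H_def normalized_def)
qed

text \<open>Stokes' formula for the chains \<open>c\<^sub>d\<close>. Insert \<open>H_cobd\<close>
  into the recursion. The constant term vanishes because \<alpha> is normalized (for
  \<open>d = 0\<close> it cancels under \<open>1 - t\<close>), and the last term vanishes by
  induction and \<open>rho_rho\<close>, that is, because the prescribed boundary is a cycle.\<close>

lemma C_cobd:
  assumes "normalized \<alpha>"
  shows "C (Suc d) (\<lambda>x. cobd x \<alpha>) = C d (rho d \<alpha>)"
  using assms
proof (induction d arbitrary: \<alpha>)
  case 0
  have "H \<alpha> [] = 0" by (simp add: H_def)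
  then show ?case by (simp add: rho_def H_cobd)
next
  case (Suc d)
  have H: "H (\<lambda>x. cobd x \<alpha>) = (\<lambda>x. \<alpha> x - \<alpha> (map (\<lambda>_. v0) x) - cobd x (H \<alpha>))"
    by (rule ext) (rule H_cobd)
  have "C (Suc (Suc d)) (\<lambda>x. cobd x \<alpha>) = C (Suc d) (rho (Suc d) (H (\<lambda>x. cobd x \<alpha>)))"
    by simp
  also have "\<dots> = C (Suc d) (rho (Suc d) \<alpha>) - C (Suc d) (rho (Suc d) (\<lambda>x. \<alpha> (map (\<lambda>_. v0) x)))
      - C (Suc d) (\<lambda>x. cobd x (rho (Suc d) (H \<alpha>)))"
    by (simp only: H rho_diff C_diff rho_cobd)
  also have "C (Suc d) (rho (Suc d) (\<lambda>x. \<alpha> (map (\<lambda>_. v0) x))) = C (Suc d) (\<lambda>x. 0)"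
  proof (rule C_cong)
    fix y assume "y \<in> G (Suc d)"
    then have len: "length y = Suc (Suc d)" by (rule G_length)
    have *: "\<alpha> (map (\<lambda>_. v0) z) = 0" if "length z = Suc (Suc d)" for z :: "'v list"
    proof -
      have "map (\<lambda>_. v0) z = [] @ v0 # v0 # replicate d v0"
        using that by (simp add: map_replicate_const)
      then show ?thesis using Suc.prems unfolding normalized_def by metis
    qed
    have **: "\<alpha> (map ((\<lambda>_. v0) \<circ> f) y) = 0" for f :: "'v \<Rightarrow> 'v"
      using *[of "map f y"] len by simp
    show "rho (Suc d) (\<lambda>x. \<alpha> (map (\<lambda>_. v0) x)) y = 0"
      using * len ** by (simp add: rho_def)
  qed
  also have "C (Suc d) (\<lambda>x. cobd x (rho (Suc d) (H \<alpha>))) = C d (rho d (rho (Suc d) (H \<alpha>)))"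
    by (rule Suc.IH) (rule normalized_rho_H[OF Suc.prems])
  also have "\<dots> = C d (\<lambda>x. 0)"
    by (rule C_cong) (rule rho_rho)
  finally show ?case by simp
qed

text \<open>The value of \<open>C d\<close> on the orbit sum of \<open>\<beta> d\<close> is an
  invariant modulo \<open>p\<close>: it starts at 1 and keeps its residue when \<open>d\<close>
  grows. For odd \<open>d\<close> the relation and \<open>C_cobd\<close> give equality
  outright.\<close>

lemma degree_mod:
  assumes nrm: "\<And>d. normalized (\<beta> d)"
    and rel: "\<And>d x. d < N \<Longrightarrow> x \<in> G (Suc d) \<Longrightarrow> cobd x (\<beta> d) = rho d (\<beta> (Suc d)) x"
    and unit: "(\<Sum>g<p. \<beta> 0 [(t ^^ g) v0]) = 1"
  shows "[C N (\<lambda>x. \<Sum>g<p. \<beta> N (map (t ^^ g) x)) = 1] (mod int p)"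
proof -
  have "[C d (\<lambda>x. \<Sum>g<p. \<beta> d (map (t ^^ g) x)) = 1] (mod int p)" if "d \<le> N" for d
    using that
  proof (induction d)
    case 0
    then show ?case by (simp add: unit)
  next
    case (Suc d)
    have "[C (Suc d) (\<lambda>x. \<Sum>g<p. \<beta> (Suc d) (map (t ^^ g) x)) =
        C d (\<lambda>x. \<Sum>g<p. \<beta> d (map (t ^^ g) x))] (mod int p)"
    proof (cases "even d")
      case False
      have "C (Suc d) (\<lambda>x. \<Sum>g<p. \<beta> (Suc d) (map (t ^^ g) x)) = C (Suc d) (\<lambda>x. cobd x (\<beta> d))"
        by (rule C_cong) (use rel[of d] Suc.prems False in \<open>simp add: rho_def\<close>)
      also have "\<dots> = C d (rho d (\<beta> d))" by (rule C_cobd) (rule nrm)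
      also have "rho d (\<beta> d) = (\<lambda>x. \<Sum>g<p. \<beta> d (map (t ^^ g) x))"
        using False by (auto simp: rho_def)
      finally show ?thesis by simp
    next
      case True
      \<comment> \<open>For even \<open>d\<close> only differences along the orbit can be compared.
        They show that \<open>u g - v g\<close> is independent of \<open>g\<close>, so the two orbit
        sums differ by \<open>p\<close> times an integer.\<close>
      define u where "u g = C (Suc d) (\<lambda>x. \<beta> (Suc d) (map (t ^^ g) x))" for g
      define v where "v g = C d (\<lambda>x. \<beta> d (map (t ^^ g) x))" for g
      have step: "u g - u (Suc g) = v g - v (Suc g)" for g
      proof -
        have "u g - u (Suc g) = C (Suc d) (\<lambda>x. cobd x (\<lambda>y. \<beta> d (map (t ^^ g) y)))"
          unfolding u_def C_diff[symmetric]
        proof (rule C_cong)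
          fix y assume "y \<in> G (Suc d)"
          then have "map (t ^^ g) y \<in> G (Suc d)" by (rule G_funpow)
          from rel[OF _ this] Suc.prems True
          show "\<beta> (Suc d) (map (t ^^ g) y) - \<beta> (Suc d) (map (t ^^ Suc g) y)
              = cobd y (\<lambda>y. \<beta> d (map (t ^^ g) y))"
            by (simp add: rho_def cobd_map)
        qed
        also have "\<dots> = C d (rho d (\<lambda>y. \<beta> d (map (t ^^ g) y)))"
          by (rule C_cobd) (intro normalized_map nrm)
        also have "\<dots> = v g - v (Suc g)"
          unfolding v_def C_diff[symmetric] using True
          by (simp add: rho_def[abs_def] funpow_Suc_right del: funpow.simps)
        finally show ?thesis .
      qed
      have eq: "u g - v g = u 0 - v 0" for g
      proof (induction g)
        case (Suc g)
        then show ?case using step[of g] by linarith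
      qed simp
      have "(\<Sum>g<p. u g - v g) = int p * (u 0 - v 0)"
      proof -
        have "(\<Sum>g<p. u g - v g) = (\<Sum>g<p. u 0 - v 0)" by (intro sum.cong refl eq)
        then show ?thesis by simp
      qed
      then have "(\<Sum>g<p. u g) - (\<Sum>g<p. v g) = int p * (u 0 - v 0)"
        by (simp only: sum_subtractf)
      then have "[(\<Sum>g<p. u g) = (\<Sum>g<p. v g)] (mod int p)"
        unfolding cong_iff_dvd_diff by (rule dvdI)
      then show ?thesis by (simp only: C_sum u_def v_def)
    qed
    moreover have "[C d (\<lambda>x. \<Sum>g<p. \<beta> d (map (t ^^ g) x)) = 1] (mod int p)"
      using Suc by simp
    ultimately show ?case by (rule cong_trans)
  qed
  then show ?thesis by simp
qed

end

section \<open>Cochains on label sets\<close>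

definition color_shift :: "nat \<Rightarrow> nat \<times> nat \<Rightarrow> nat \<times> nat" where
  "color_shift p = (\<lambda>(i, j). (i, (j + 1) mod p))"

text \<open>The simplices of a join of boundaries of (p-1)-dimensional simplices, one for each
  \<open>i\<close>.\<close>

definition proper :: "nat \<Rightarrow> (nat \<times> nat) set \<Rightarrow> bool" where
  "proper p X \<longleftrightarrow> (\<forall>i j. (i, j) \<in> X \<longrightarrow> j < p) \<and> (\<forall>i. \<exists>j<p. (i, j) \<notin> X)"

text \<open>Restricting to one group keeps the number of colors of a nonempty proper set strictly
  between 0 and \<open>p\<close>; the smallest group index is invariant under the color
  shift.\<close>

definition first_colors :: "(nat \<times> nat) set \<Rightarrow> nat set" where
  "first_colors X = {j. (LEAST i. \<exists>j. (i, j) \<in> X, j) \<in> X}"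

text \<open>An equivariant map from nonempty proper label sets to \<open>\<int>/p\<close>: shifting all colors in \<open>Y = first_colors X\<close> by
  one increases \<open>\<Sum>Y / card Y\<close> by one, and \<open>card Y\<close> is invertible because \<open>0 < card Y < p\<close> and \<open>p\<close> is
  prime.\<close>

definition phase :: "nat \<Rightarrow> (nat \<times> nat) set \<Rightarrow> nat" where
  "phase p X =
     ((SOME a. [a * card (first_colors X) = 1] (mod p)) * \<Sum>(first_colors X)) mod p"

lemma funpow_color_shift: "j < p \<Longrightarrow> (color_shift p ^^ g) (i, j) = (i, (j + g) mod p)"
  by (induction g) (auto simp: color_shift_def mod_Suc_eq)

lemma proper_subset: "proper p X \<Longrightarrow> Y \<subseteq> X \<Longrightarrow> proper p Y"
  unfolding proper_def by (meson subset_iff)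

lemma mod_shift_inj: "inj_on (\<lambda>j::nat. (j + 1) mod p) {..<p}"
proof (rule inj_onI)
  fix a b assume "a \<in> {..<p}" "b \<in> {..<p}" "(a + 1) mod p = (b + 1) mod p"
  then show "a = b"
    by (cases "a + 1 = p"; cases "b + 1 = p") auto
qed

lemma proper_color_shift:
  assumes "proper p X"
  shows "proper p (color_shift p ` X)"
  unfolding proper_def
proof (intro conjI allI impI)
  fix i
  obtain j where j: "j < p" "(i, j) \<notin> X" using assms unfolding proper_def by blast
  have "(i, (j + 1) mod p) \<notin> color_shift p ` X"
  proof
    assume "(i, (j + 1) mod p) \<in> color_shift p ` X"
    then obtain j' where "(i, j') \<in> X" "(j' + 1) mod p = (j + 1) mod p"
      by (auto simp: color_shift_def)
    moreover have "j' < p" using \<open>(i, j') \<in> X\<close> assms by (auto simp: proper_def)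
    ultimately have "j' = j" using mod_shift_inj[of p] j by (auto dest: inj_onD)
    with j \<open>(i, j') \<in> X\<close> show False by simp
  qed
  then show "\<exists>j<p. (i, j) \<notin> color_shift p ` X" using j by (intro exI[of _ "(j + 1) mod p"]) auto
next
  fix i j assume "(i, j) \<in> color_shift p ` X"
  then show "j < p" using assms by (auto simp: color_shift_def proper_def intro!: mod_less_divisor)
qed

lemma first_colors_color_shift:
  "first_colors (color_shift p ` X) = (\<lambda>j. (j + 1) mod p) ` first_colors X"
proof -
  have "(\<exists>j. (i, j) \<in> color_shift p ` X) \<longleftrightarrow> (\<exists>j. (i, j) \<in> X)" for i
    by (auto simp: color_shift_def image_iff split: prod.splits)
  then have "(LEAST i. \<exists>j. (i, j) \<in> color_shift p ` X) = (LEAST i. \<exists>j. (i, j) \<in> X)" by simp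
  then show ?thesis by (auto simp: first_colors_def color_shift_def image_iff split: prod.splits)
qed

lemma phase_less: "p > 0 \<Longrightarrow> phase p X < p"
  by (simp add: phase_def)

lemma phase_color_shift:
  assumes p: "prime p" and X: "proper p X" "X \<noteq> {}"
  shows "phase p (color_shift p ` X) = (phase p X + 1) mod p"
proof -
  define Y where "Y = first_colors X"
  define Z where "Z = first_colors (color_shift p ` X)"
  have YZ: "Z = (\<lambda>j. (j + 1) mod p) ` Y" by (simp add: Y_def Z_def first_colors_color_shift)
  have Yp: "Y \<subseteq> {..<p}" using X by (auto simp: Y_def first_colors_def proper_def)
  have inj: "inj_on (\<lambda>j. (j + 1) mod p) Y" using mod_shift_inj Yp by (rule inj_on_subset)
  \<comment> \<open>Equal cardinalities make \<open>phase\<close> choose the same inverse for both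
    sets.\<close>
  have card: "card Z = card Y" unfolding YZ using inj by (rule card_image)
  obtain i j where "(i, j) \<in> X" using X(2) by auto
  then have "\<exists>i j. (i, j) \<in> X" by blast
  then have "\<exists>j. (LEAST i. \<exists>j. (i, j) \<in> X, j) \<in> X" by (rule LeastI_ex)
  then have "Y \<noteq> {}" by (auto simp: Y_def first_colors_def)
  have fin: "finite Y" using Yp finite_subset by blast
  have "Y \<noteq> {..<p}" using X(1) by (auto simp: Y_def first_colors_def proper_def)
  then have "card Y < p" using Yp psubset_card_mono[of "{..<p}" Y] by auto
  moreover have "card Y > 0" using \<open>Y \<noteq> {}\<close> fin by (simp add: card_gt_0_iff)
  ultimately have "coprime (card Y) p"
    using p by (metis coprime_commute nat_dvd_not_less prime_imp_coprime)
  then obtain a0 where "[card Y * a0 = 1] (mod p)" using cong_solve_coprime_nat by auto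
  then have ex: "\<exists>a. [a * card Y = 1] (mod p)" by (auto simp: mult.commute)
  define a where "a = (SOME a. [a * card Y = 1] (mod p))"
  have a: "[a * card Y = 1] (mod p)" unfolding a_def using ex by (rule someI_ex)
  have "[\<Sum>Z = \<Sum>j\<in>Y. j + 1] (mod p)"
    unfolding YZ sum.reindex[OF inj] by (auto intro!: cong_sum)
  moreover have "(\<Sum>j\<in>Y. j + 1) = \<Sum>Y + card Y" by (simp only: sum.distrib card_eq_sum)
  ultimately have "[a * \<Sum>Z = a * (\<Sum>Y + card Y)] (mod p)" by (simp only: cong_scalar_left)
  then have "[a * \<Sum>Z = a * \<Sum>Y + a * card Y] (mod p)" by (simp only: distrib_left)
  also have "[a * \<Sum>Y + a * card Y = a * \<Sum>Y + 1] (mod p)"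
    using a by (rule cong_add[OF cong_refl])
  finally have "a * \<Sum>Z mod p = (a * \<Sum>Y mod p + 1) mod p"
    by (simp add: unique_euclidean_semiring_class.cong_def mod_Suc_eq)
  then show ?thesis
    by (simp add: phase_def card[unfolded Y_def Z_def] a_def Y_def Z_def)
qed

text \<open>These cochains satisfy the relations dual to those of the chains \<open>c\<^sub>d\<close>. Since they alternate,
  they vanish on lists with a repeated label.\<close>

primrec label_cochain :: "nat \<Rightarrow> nat \<Rightarrow> (nat \<times> nat) list \<Rightarrow> int" where
  "label_cochain p 0 x = (if length x = 1 \<and> phase p (set x) = 0 then 1 else 0)"
| "label_cochain p (Suc d) x =
     (if even d then \<Sum>s<p - phase p (set x). cobd (map (color_shift p ^^ s) x) (label_cochain p d)
      else if phase p (set x) = 0 then cobd x (label_cochain p d) else 0)"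

lemma alternating_label_cochain: "alternating (label_cochain p d)"
proof (induction d)
  case 0
  show ?case by (rule alternatingI) auto
next
  case (Suc d)
  note alt = alternating_cobd[OF Suc]
  show ?case
  proof (rule alternatingI)
    fix u a w
    show "label_cochain p (Suc d) (u @ a # a # w) = 0"
      using alternating_repeat[OF alt] by simp
  next
    fix u w :: "(nat \<times> nat) list" and a b
    have "set (u @ a # b # w) = set (u @ b # a # w)" by auto
    moreover have "cobd (map f (u @ a # b # w)) (label_cochain p d) =
        - cobd (map f (u @ b # a # w)) (label_cochain p d)" for f
      using alternating_swap[OF alt, of "map f u" "f a" "f b" "map f w"] by simp
    moreover have "cobd (u @ a # b # w) (label_cochain p d) =
        - cobd (u @ b # a # w) (label_cochain p d)"
      by (rule alternating_swap[OF alt])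
    ultimately show "label_cochain p (Suc d) (u @ a # b # w) = - label_cochain p (Suc d) (u @ b # a # w)"
      unfolding label_cochain.simps by (simp only: sum_negf if_distrib[of uminus] minus_zero cong: if_cong)
  qed
qed

section \<open>Relations between the label cochains\<close>

context
  fixes p :: nat
  assumes p: "prime p"
begin

lemma proper_funpow:
  assumes "proper p X"
  shows "proper p ((color_shift p ^^ g) ` X)"
proof (induction g)
  case (Suc g)
  then show ?case using proper_color_shift[OF Suc] by (simp add: image_comp)
qed (use assms in simp)

lemma phase_funpow:
  assumes "proper p X" "X \<noteq> {}"
  shows "phase p ((color_shift p ^^ g) ` X) = (phase p X + g) mod p"
proof (induction g)
  case 0
  show ?case using phase_less[of p X] prime_gt_0_nat[OF p] by simp
next
  case (Suc g)
  have "(color_shift p ^^ Suc g) ` X = color_shift p ` ((color_shift p ^^ g) ` X)"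
    by (simp add: image_comp)
  then have "phase p ((color_shift p ^^ Suc g) ` X) = (phase p ((color_shift p ^^ g) ` X) + 1) mod p"
    using phase_color_shift[OF p proper_funpow[OF assms(1)], of g] assms(2) by simp
  then show ?case by (simp add: Suc mod_Suc_eq)
qed

lemma funpow_period:
  assumes "proper p (set x)"
  shows "map (color_shift p ^^ p) x = x"
proof (rule map_idI)
  fix v assume "v \<in> set x"
  moreover obtain i j where "v = (i, j)" by fastforce
  ultimately show "(color_shift p ^^ p) v = v"
    using assms by (auto simp: funpow_color_shift proper_def)
qed

text \<open>Each shift raises the phase by one modulo \<open>p\<close>, so phase 0 selects exactly
  one member of every orbit.\<close>

lemma unique_phase_sum:
  fixes c :: int
  assumes "proper p X" "X \<noteq> {}"
  shows "(\<Sum>g<p. if phase p ((color_shift p ^^ g) ` X) = 0 then c else 0) = c"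
proof -
  have p0: "p > 0" using p by (rule prime_gt_0_nat)
  define q where "q = phase p X"
  have q: "q < p" unfolding q_def by (rule phase_less[OF p0])
  define g0 where "g0 = (if q = 0 then 0 else p - q)"
  have "(q + g) mod p = 0 \<longleftrightarrow> g = g0" if "g < p" for g
  proof
    assume "(q + g) mod p = 0"
    then show "g = g0" using q that unfolding g0_def
      by (cases "q + g < p") (auto simp: mod_if split: if_splits)
  qed (use q that in \<open>auto simp: g0_def\<close>)
  then have "(\<Sum>g<p. if phase p ((color_shift p ^^ g) ` X) = 0 then c else 0) =
      (\<Sum>g<p. if g = g0 then c else 0)"
    by (intro sum.cong refl) (simp add: phase_funpow[OF assms] q_def)
  also have "\<dots> = c" using q by (simp add: g0_def)
  finally show ?thesis .
qed

text \<open>Each cochain is defined to solve this equation. For even \<open>d\<close> the coboundary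
  has orbit sum zero, so its partial sums along the orbit, taken until the phase returns to 0,
  invert \<open>1 - t\<close>. For odd \<open>d\<close> the coboundary is shift invariant, so
  placing it on the phase 0 member of each orbit inverts the norm.\<close>

lemma cobd_label_cochain:
  assumes "proper p (set x)" "length x = Suc (Suc d)"
  shows "cobd x (label_cochain p d) =
    (if even d then label_cochain p (Suc d) x - label_cochain p (Suc d) (map (color_shift p) x)
     else \<Sum>g<p. label_cochain p (Suc d) (map (color_shift p ^^ g) x))"
  using assms
proof (induction d arbitrary: x rule: less_induct)
  case (less d)
  have p0: "p > 0" using p by (rule prime_gt_0_nat)
  have ne: "set x \<noteq> {}" using less.prems by auto
  define F where "F g = cobd (map (color_shift p ^^ g) x) (label_cochain p d)" for g
  define q where "q = phase p (set x)"
  have q: "q < p" unfolding q_def by (rule phase_less[OF p0])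
  have sub: "proper p (set y)" if "set y \<subseteq> set x" for y
    using proper_subset[OF less.prems(1) that] .
  show ?case
  proof (cases "even d")
    case True
    \<comment> \<open>The orbit sum of \<open>label_cochain p d\<close> is the coboundary of the
      preceding cochain, or the constant 1 if \<open>d = 0\<close>; either way its coboundary
      vanishes.\<close>
    have sumF: "(\<Sum>g<p. F g) = 0"
    proof -
      have "(\<Sum>g<p. F g) = cobd x (\<lambda>y. \<Sum>g<p. label_cochain p d (map (color_shift p ^^ g) y))"
        by (simp add: F_def cobd_sum cobd_map)
      also have "\<dots> = 0"
      proof (cases d)
        case 0
        have "cobd x (\<lambda>y. \<Sum>g<p. label_cochain p d (map (color_shift p ^^ g) y)) = cobd x (\<lambda>y. 1)"
        proof (rule cobd_cong)
          fix y assume y: "set y \<subseteq> set x" "Suc (length y) = length x"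
          then have "set y \<noteq> {}" using less.prems by auto
          from unique_phase_sum[OF sub[OF y(1)] this, of 1] y less.prems 0
          show "(\<Sum>g<p. label_cochain p d (map (color_shift p ^^ g) y)) = 1"
            by simp
        qed
        also have "\<dots> = 0" using less.prems 0 by (auto simp: length_Suc_conv)
        finally show ?thesis .
      next
        case (Suc e)
        have "cobd x (\<lambda>y. \<Sum>g<p. label_cochain p d (map (color_shift p ^^ g) y)) =
            cobd x (\<lambda>y. cobd y (label_cochain p e))"
        proof (rule cobd_cong)
          fix y assume y: "set y \<subseteq> set x" "Suc (length y) = length x"
          from less.IH[of e y] sub[OF y(1)] y less.prems True Suc
          show "(\<Sum>g<p. label_cochain p d (map (color_shift p ^^ g) y)) = cobd y (label_cochain p e)"
            by simp
        qed
        then show ?thesis by (simp add: cobd_cobd)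
      qed
      finally show ?thesis .
    qed
    have shift: "cobd (map (color_shift p ^^ s) (map (color_shift p) x)) (label_cochain p d) = F (Suc s)" for s
      by (simp add: F_def funpow_Suc_right del: funpow.simps)
    have "phase p (set (map (color_shift p) x)) = (q + 1) mod p"
      using phase_color_shift[OF p less.prems(1) ne] by (simp add: q_def)
    then have "label_cochain p (Suc d) (map (color_shift p) x) = (\<Sum>s<p - (q + 1) mod p. F (Suc s))"
      using True by (simp only: label_cochain.simps if_True shift)
    \<comment> \<open>A shift removes the first term of the partial sum. At the wraparound
      \<open>q + 1 = p\<close> the new sum runs over the whole orbit and is zero by
      \<open>sumF\<close>.\<close>
    also have "\<dots> = (\<Sum>s<p - q. F s) - F 0"
    proof (cases "q + 1 = p")
      case True
      then have "p - (q + 1) mod p = p" "p - q = 1" by auto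
      moreover have "(\<Sum>s<p. F (Suc s)) = (\<Sum>s<Suc p. F s) - F 0"
        by (simp only: sum.lessThan_Suc_shift)
      moreover have "F p = F 0" using funpow_period[OF less.prems(1)] by (simp add: F_def)
      ultimately show ?thesis by (simp add: sumF)
    next
      case False
      then have "(q + 1) mod p = q + 1" "p - q = Suc (p - (q + 1))" using q by auto
      then show ?thesis by (simp only: sum.lessThan_Suc_shift)
    qed
    finally show ?thesis using True by (simp add: F_def q_def)
  next
    case False
    then obtain e where e: "d = Suc e" by (cases d) auto
    \<comment> \<open>By the preceding relation, the difference of two neighboring values is a
      coboundary of a coboundary.\<close>
    have inv: "F (Suc g) = F g" for g
    proof -
      define z where "z = map (color_shift p ^^ g) x"
      have z: "proper p (set z)" "length z = length x"
        using proper_funpow[OF less.prems(1)] by (auto simp: z_def)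
      have "F g - F (Suc g) = cobd z (label_cochain p d) - cobd (map (color_shift p) z) (label_cochain p d)"
        by (simp add: F_def z_def)
      also have "\<dots> = cobd z (\<lambda>y. label_cochain p d y - label_cochain p d (map (color_shift p) y))"
        by (simp add: cobd_map cobd_diff)
      also have "\<dots> = cobd z (\<lambda>y. cobd y (label_cochain p e))"
      proof (rule cobd_cong)
        fix y assume y: "set y \<subseteq> set z" "Suc (length y) = length z"
        from less.IH[of e y] proper_subset[OF z(1) y(1)] y z less.prems False e
        show "label_cochain p d y - label_cochain p d (map (color_shift p) y) = cobd y (label_cochain p e)"
          by simp
      qed
      also have "\<dots> = 0" by (rule cobd_cobd)
      finally show ?thesis by simp
    qed
    have F0: "F g = F 0" for g by (induction g) (simp_all add: inv)
    have "(\<Sum>g<p. label_cochain p (Suc d) (map (color_shift p ^^ g) x)) =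
        (\<Sum>g<p. if phase p ((color_shift p ^^ g) ` set x) = 0 then F g else 0)"
      unfolding F_def using False by simp
    also have "\<dots> = (\<Sum>g<p. if phase p ((color_shift p ^^ g) ` set x) = 0 then F 0 else 0)"
      by (intro sum.cong refl if_cong F0)
    also have "\<dots> = F 0" by (rule unique_phase_sum[OF less.prems(1) ne])
    also have "F 0 = cobd x (label_cochain p d)" by (simp add: F_def)
    finally show ?thesis using False by simp
  qed
qed

end

text \<open>Otherwise all label sets up to dimension \<open>N = n * (p - 1)\<close> are proper, and
  the pulled back label cochains have degree 1 modulo \<open>p\<close>. But omitting one color in
  each of \<open>n\<close> groups leaves only \<open>N\<close> labels, while lists in
  \<open>G N\<close> have \<open>N + 1\<close> entries. So labels repeat, and the alternating top
  cochain vanishes.\<close>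

theorem (in sweep) full_group_exists:
  fixes lab :: "'v \<Rightarrow> nat \<times> nat"
  assumes p: "prime p"
    and equiv: "\<And>d x v. x \<in> G d \<Longrightarrow> v \<in> set x \<Longrightarrow> lab (t v) = color_shift p (lab v)"
    and range: "\<And>d x v. d \<le> n * (p - 1) \<Longrightarrow> x \<in> G d \<Longrightarrow> v \<in> set x \<Longrightarrow> lab v \<in> {..<n} \<times> {..<p}"
  shows "\<exists>d\<le>n * (p - 1). \<exists>x\<in>G d. \<exists>i<n. \<forall>j<p. (i, j) \<in> lab ` set x"
proof (rule ccontr)
  define N where "N = n * (p - 1)"
  assume "\<not> ?thesis"
  then have nf: "\<exists>j<p. (i, j) \<notin> lab ` set x" if "d \<le> N" "x \<in> G d" "i < n" for d x i
    using that unfolding N_def by blast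
  have p0: "p > 0" "p > 1" using p prime_gt_0_nat prime_gt_1_nat by auto
  have proper: "proper p (set (map lab x))" if "d \<le> N" "x \<in> G d" for d x
    unfolding proper_def
  proof (intro conjI allI impI)
    fix i
    show "\<exists>j<p. (i, j) \<notin> set (map lab x)"
    proof (cases "i < n")
      case True
      then show ?thesis using nf[OF that] by simp
    next
      case False
      then have "(i, 0) \<notin> set (map lab x)" using range[of d x] that unfolding N_def by fastforce
      then show ?thesis using p0 by blast
    qed
  next
    fix i j assume "(i, j) \<in> set (map lab x)"
    then show "j < p" using range[of d x] that unfolding N_def by fastforce
  qed
  have map_t: "map lab (map (t ^^ g) x) = map (color_shift p ^^ g) (map lab x)" if "x \<in> G d" for g x d
  proof (induction g)
    case (Suc g)
    have "map lab (map (t ^^ Suc g) x) = map (\<lambda>v. lab (t v)) (map (t ^^ g) x)" by simp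
    also have "\<dots> = map (\<lambda>v. color_shift p (lab v)) (map (t ^^ g) x)"
      using equiv[OF G_funpow[OF that, of g]] by (intro map_cong refl) auto
    also have "\<dots> = map (color_shift p) (map lab (map (t ^^ g) x))" by simp
    finally show ?case unfolding Suc by simp
  qed simp
  define \<beta> where "\<beta> d x = label_cochain p d (map lab x)" for d x
  have "[C N (\<lambda>x. \<Sum>g<p. \<beta> N (map (t ^^ g) x)) = 1] (mod int p)"
  proof (rule degree_mod)
    show "normalized (\<beta> d)" for d
      using alternating_label_cochain[of p d] unfolding \<beta>_def[abs_def] alternating_def
      by (blast intro: normalized_map)
    show "cobd x (\<beta> d) = rho d (\<beta> (Suc d)) x" if "d < N" "x \<in> G (Suc d)" for d x
    proof -
      have "cobd x (\<beta> d) = cobd (map lab x) (label_cochain p d)"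
        by (simp add: \<beta>_def[abs_def] cobd_map)
      also have "\<dots> = rho d (\<beta> (Suc d)) x"
        using cobd_label_cochain[OF p proper[OF _ that(2)]] that G_length[OF that(2)]
          map_t[OF that(2)] map_t[OF that(2), of 1]
        by (simp add: rho_def \<beta>_def del: label_cochain.simps map_map)
      finally show ?thesis .
    qed
    have "(\<Sum>g<p. \<beta> 0 [(t ^^ g) v0]) =
        (\<Sum>g<p. if phase p ((color_shift p ^^ g) ` {lab v0}) = 0 then 1 else 0)"
      using map_t[OF G_0] by (simp add: \<beta>_def)
    also have "\<dots> = 1"
      using proper[OF _ G_0] by (intro unique_phase_sum[OF p]) auto
    finally show "(\<Sum>g<p. \<beta> 0 [(t ^^ g) v0]) = 1" .
  qed
  moreover have "C N (\<lambda>x. \<Sum>g<p. \<beta> N (map (t ^^ g) x)) = C N (\<lambda>x. 0)"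
  proof (rule C_cong)
    have zero: "\<beta> N x = 0" if x: "x \<in> G N" for x
    proof -
      have "\<not> distinct (map lab x)"
      proof
        assume "distinct (map lab x)"
        then have card: "card (set (map lab x)) = Suc N"
          using G_length[OF x] by (metis distinct_card length_map)
        have "\<forall>i\<in>{..<n}. \<exists>j<p. (i, j) \<notin> set (map lab x)"
          using proper[OF le_refl x] by (auto simp: proper_def)
        then obtain m where m: "\<And>i. i < n \<Longrightarrow> m i < p \<and> (i, m i) \<notin> set (map lab x)"
          by (metis lessThan_iff)
        have "set (map lab x) \<subseteq> (SIGMA i:{..<n}. {..<p} - {m i})"
          using range[of N x] x m unfolding N_def by force
        then have "card (set (map lab x)) \<le> card (SIGMA i:{..<n}. {..<p} - {m i})"
          by (intro card_mono) auto
        also have "\<dots> = (\<Sum>i<n. card ({..<p} - {m i}))" by simp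
        also have "\<dots> = (\<Sum>i<n. p - 1)" using m by (intro sum.cong) auto
        also have "\<dots> = N" by (simp add: N_def)
        finally show False using card by simp
      qed
      then show ?thesis
        unfolding \<beta>_def by (rule alternating_not_distinct[OF alternating_label_cochain])
    qed
    then show "(\<Sum>g<p. \<beta> N (map (t ^^ g) x)) = 0" if "x \<in> G N" for x
      using G_funpow[OF that] by simp
  qed
  ultimately have "[0 = 1] (mod int p)" by simp
  then show False using p0 by (simp add: unique_euclidean_semiring_class.cong_def)
qed

section \<open>Concentration\<close>

definition avg :: "'b set \<Rightarrow> ('b \<Rightarrow> real) \<Rightarrow> real" where
  "avg A f = (\<Sum>x\<in>A. f x) / real (card A)"

lemma avg_mono: "(\<And>x. x \<in> A \<Longrightarrow> f x \<le> g x) \<Longrightarrow> avg A f \<le> avg A g"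
  unfolding avg_def by (intro divide_right_mono sum_mono) auto

lemma avg_cmult: "avg A (\<lambda>x. c * f x) = c * avg A f"
  by (simp add: avg_def sum_distrib_left)

lemma avg_const: "finite A \<Longrightarrow> A \<noteq> {} \<Longrightarrow> avg A (\<lambda>_. c) = c"
  by (simp add: avg_def)

lemma avg_diff: "avg A (\<lambda>x. f x - g x) = avg A f - avg A g"
  by (simp add: avg_def sum_subtractf diff_divide_distrib)

lemma avg_sum: "avg A (\<lambda>x. \<Sum>i\<in>I. f i x) = (\<Sum>i\<in>I. avg A (f i))"
  unfolding avg_def by (subst sum.swap) (simp add: sum_divide_distrib)

text \<open>Hoeffding's lemma for the uniform distribution on \<open>U\<close>: integrals are
  averages, and the interval from the minimum to the maximum of \<open>g\<close> has length at most
  \<open>c\<close>.\<close>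

lemma avg_exp_centered_pos:
  fixes g :: "'b \<Rightarrow> real"
  assumes U: "finite U" "U \<noteq> {}" and s: "s > 0"
    and diam: "\<And>u v. u \<in> U \<Longrightarrow> v \<in> U \<Longrightarrow> g u - g v \<le> c"
  shows "avg U (\<lambda>u. exp (s * (g u - avg U g))) \<le> exp (s\<^sup>2 * c\<^sup>2 / 8)"
proof -
  define M where "M = measure_pmf (pmf_of_set U)"
  have set: "set_pmf (pmf_of_set U) = U" using U by (intro set_pmf_of_set)
  define a where "a = Min (g ` U)"
  define b where "b = Max (g ` U)"
  have ab: "a \<le> g u" "g u \<le> b" if "u \<in> U" for u using that U by (auto simp: a_def b_def)
  have "a \<in> g ` U" "b \<in> g ` U" using U by (auto simp: a_def b_def intro!: Min_in Max_in)
  then have ba: "b - a \<le> c" "0 \<le> b - a" using diam ab by auto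
  have ps: "prob_space M" unfolding M_def by (rule prob_space_measure_pmf)
  have AE: "AE u in M. g u \<in> {a..b}"
    unfolding M_def AE_measure_pmf_iff set using ab by auto
  interpret I: interval_bounded_random_variable M g a b
    by (intro interval_bounded_random_variable.intro interval_bounded_random_variable_axioms.intro ps AE)
      (simp add: M_def)
  have E: "integral\<^sup>L M f = avg U f" for f :: "'b \<Rightarrow> real"
    unfolding M_def avg_def by (intro integral_pmf_of_set U)
  have nn: "nn_integral M (\<lambda>x. ennreal (f x)) = ennreal (avg U f)" if "\<And>u. f u \<ge> 0" for f
    unfolding E[symmetric]
    by (rule nn_integral_eq_integral)
      (simp_all add: M_def integrable_measure_pmf_finite set U that)
  from I.Hoeffdings_lemma_nn_integral[OF s]
  have "avg U (\<lambda>u. exp (s * (g u - avg U g))) \<le> exp (s\<^sup>2 * (b - a)\<^sup>2 / 8)"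
    by (simp add: E nn)
  also have "\<dots> \<le> exp (s\<^sup>2 * c\<^sup>2 / 8)"
    using ba by (auto intro!: mult_left_mono power_mono)
  finally show ?thesis .
qed

lemma avg_PiE_insert:
  assumes "finite A" "a \<notin> A"
  shows "avg (insert a A \<rightarrow>\<^sub>E U) F = avg (A \<rightarrow>\<^sub>E U) (\<lambda>r. avg U (\<lambda>u. F (r(a := u))))"
proof -
  have "(\<Sum>r\<in>insert a A \<rightarrow>\<^sub>E U. F r) = (\<Sum>(u, r)\<in>U \<times> (A \<rightarrow>\<^sub>E U). F (r(a := u)))"
    unfolding PiE_insert_eq using inj_combinator[OF assms(2), of "\<lambda>_. U"]
    by (subst sum.reindex) (auto simp: case_prod_unfold)
  also have "\<dots> = (\<Sum>r\<in>A \<rightarrow>\<^sub>E U. \<Sum>u\<in>U. F (r(a := u)))"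
    by (subst sum.swap) (simp add: sum.cartesian_product)
  finally show ?thesis using assms
    by (simp add: avg_def card_PiE sum_divide_distrib)
qed

text \<open>Induction over the coordinates replaces the martingale. \<open>G\<close> is
  \<open>F\<close> with coordinate \<open>a\<close> averaged out; Hoeffding's lemma bounds the
  moment of \<open>F - G\<close> in that coordinate, and \<open>G\<close> inherits the bounded
  differences in the others.\<close>

lemma mcdiarmid_mgf:
  fixes F :: "('a \<Rightarrow> 'b) \<Rightarrow> real" and c :: "'a \<Rightarrow> real"
  assumes U: "finite U" "U \<noteq> {}" and s: "s > 0" and A: "finite A"
    and diam: "\<And>r a u v. r \<in> A \<rightarrow>\<^sub>E U \<Longrightarrow> a \<in> A \<Longrightarrow> u \<in> U \<Longrightarrow> v \<in> U \<Longrightarrow>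
      F (r(a := u)) - F (r(a := v)) \<le> c a"
  shows "avg (A \<rightarrow>\<^sub>E U) (\<lambda>r. exp (s * (F r - avg (A \<rightarrow>\<^sub>E U) F))) \<le> exp (s\<^sup>2 * (\<Sum>a\<in>A. (c a)\<^sup>2) / 8)"
  using A diam
proof (induction A arbitrary: F rule: finite_induct)
  case empty
  show ?case by (simp add: avg_def)
next
  case (insert a A)
  define G where "G r = avg U (\<lambda>u. F (r(a := u)))" for r
  have upd: "r(a := w) \<in> insert a A \<rightarrow>\<^sub>E U" if "r \<in> A \<rightarrow>\<^sub>E U" "w \<in> U" for r w
    using that insert.hyps by (auto simp: PiE_def extensional_def)
  have EF: "avg (insert a A \<rightarrow>\<^sub>E U) F = avg (A \<rightarrow>\<^sub>E U) G"
    unfolding G_def by (rule avg_PiE_insert[OF insert.hyps])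
  have G: "G (r(b := u)) - G (r(b := v)) \<le> c b"
    if "r \<in> A \<rightarrow>\<^sub>E U" "b \<in> A" "u \<in> U" "v \<in> U" for r b u v
  proof -
    have "b \<noteq> a" using that insert.hyps by auto
    have "G (r(b := u)) - G (r(b := v)) \<le> avg U (\<lambda>_. c b)"
      unfolding G_def avg_diff[symmetric]
    proof (rule avg_mono)
      fix w assume "w \<in> U"
      from insert.prems[OF upd[OF that(1) this], of b u v] that \<open>b \<noteq> a\<close>
      show "F (r(b := u, a := w)) - F (r(b := v, a := w)) \<le> c b"
        by (simp add: fun_upd_twist del: fun_upd_apply)
    qed
    then show ?thesis using U by (simp add: avg_const)
  qed
  have "avg (insert a A \<rightarrow>\<^sub>E U) (\<lambda>r. exp (s * (F r - avg (insert a A \<rightarrow>\<^sub>E U) F))) =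
      avg (A \<rightarrow>\<^sub>E U) (\<lambda>r. avg U (\<lambda>u. exp (s * (F (r(a := u)) - avg (A \<rightarrow>\<^sub>E U) G))))"
    unfolding EF by (rule avg_PiE_insert[OF insert.hyps])
  also have "\<dots> = avg (A \<rightarrow>\<^sub>E U) (\<lambda>r. exp (s * (G r - avg (A \<rightarrow>\<^sub>E U) G)) *
      avg U (\<lambda>u. exp (s * (F (r(a := u)) - G r))))"
    unfolding avg_cmult[symmetric] exp_add[symmetric] by (simp add: algebra_simps)
  also have "\<dots> \<le> avg (A \<rightarrow>\<^sub>E U) (\<lambda>r. exp (s * (G r - avg (A \<rightarrow>\<^sub>E U) G)) * exp (s\<^sup>2 * (c a)\<^sup>2 / 8))"
  proof (intro avg_mono mult_left_mono)
    fix r assume r: "r \<in> A \<rightarrow>\<^sub>E U"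
    have "F (r(a := u)) - F (r(a := v)) \<le> c a" if "u \<in> U" "v \<in> U" for u v
      using insert.prems[OF upd[OF r that(1)], of a u v] that by (simp del: fun_upd_apply)
    then show "avg U (\<lambda>u. exp (s * (F (r(a := u)) - G r))) \<le> exp (s\<^sup>2 * (c a)\<^sup>2 / 8)"
      unfolding G_def by (intro avg_exp_centered_pos U s)
  qed auto
  also have "\<dots> = exp (s\<^sup>2 * (c a)\<^sup>2 / 8) * avg (A \<rightarrow>\<^sub>E U) (\<lambda>r. exp (s * (G r - avg (A \<rightarrow>\<^sub>E U) G)))"
    by (subst mult.commute) (simp add: avg_cmult)
  also have "\<dots> \<le> exp (s\<^sup>2 * (c a)\<^sup>2 / 8) * exp (s\<^sup>2 * (\<Sum>a\<in>A. (c a)\<^sup>2) / 8)"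
    by (intro mult_left_mono insert.IH G) auto
  also have "\<dots> = exp (s\<^sup>2 * (\<Sum>a\<in>insert a A. (c a)\<^sup>2) / 8)"
    using insert.hyps by (simp add: exp_add[symmetric] algebra_simps add_divide_distrib)
  finally show ?case .
qed

text \<open>If every \<open>r\<close> violated some bound, the exponential moments summed over
  \<open>I\<close> and both signs would average at least \<open>exp (s * t)\<close>, which
  \<open>small\<close> excludes.\<close>

lemma mcdiarmid_union:
  fixes F :: "'i \<Rightarrow> ('a \<Rightarrow> 'b) \<Rightarrow> real" and c :: "'a \<Rightarrow> real"
  assumes U: "finite U" "U \<noteq> {}" and A: "finite A" and I: "finite I"
    and diam: "\<And>i r a u v. i \<in> I \<Longrightarrow> r \<in> A \<rightarrow>\<^sub>E U \<Longrightarrow> a \<in> A \<Longrightarrow> u \<in> U \<Longrightarrow> v \<in> U \<Longrightarrow>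
      \<bar>F i (r(a := u)) - F i (r(a := v))\<bar> \<le> c a"
    and N: "(\<Sum>a\<in>A. (c a)\<^sup>2) \<le> N" "N > 0" and t: "t > 0"
    and small: "2 * real (card I) * exp (- (2 * t\<^sup>2 / N)) < 1"
  shows "\<exists>r\<in>A \<rightarrow>\<^sub>E U. \<forall>i\<in>I. \<bar>F i r - avg (A \<rightarrow>\<^sub>E U) (F i)\<bar> < t"
proof (rule ccontr)
  let ?\<Omega> = "A \<rightarrow>\<^sub>E U"
  assume "\<not> ?thesis"
  then have big: "\<exists>i\<in>I. t \<le> \<bar>F i r - avg ?\<Omega> (F i)\<bar>" if "r \<in> ?\<Omega>" for r
    using that by (meson not_le)
  \<comment> \<open>This value minimizes the exponent
    \<open>s\<^sup>2 * N / 8 - s * t\<close>.\<close>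
  define s where "s = 4 * t / N"
  have s: "s > 0" using t N by (simp add: s_def)
  define P where "P \<sigma> i r = exp (s * (\<sigma> * F i r - avg ?\<Omega> (\<lambda>r. \<sigma> * F i r)))" for \<sigma> :: real and i r
  have fin: "finite ?\<Omega>" "?\<Omega> \<noteq> {}" using A U by (auto intro: finite_PiE simp: PiE_eq_empty_iff)
  have P: "avg ?\<Omega> (P \<sigma> i) \<le> exp (2 * t\<^sup>2 / N)" if "i \<in> I" "\<sigma> \<in> {1, -1}" for i \<sigma>
  proof -
    have "avg ?\<Omega> (P \<sigma> i) \<le> exp (s\<^sup>2 * (\<Sum>a\<in>A. (c a)\<^sup>2) / 8)"
      unfolding P_def using diam[OF that(1)] that(2)
      by (intro mcdiarmid_mgf U s A) (force simp: abs_le_iff)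
    also have "\<dots> \<le> exp (s\<^sup>2 * N / 8)" using N by (auto intro!: mult_left_mono)
    also have "s\<^sup>2 * N / 8 = 2 * t\<^sup>2 / N"
      using N by (simp add: s_def field_simps power2_eq_square)
    finally show ?thesis .
  qed
  have "exp (s * t) = avg ?\<Omega> (\<lambda>_. exp (s * t))" using fin by (simp add: avg_const)
  also have "\<dots> \<le> avg ?\<Omega> (\<lambda>r. \<Sum>i\<in>I. P 1 i r + P (-1) i r)"
  proof (rule avg_mono)
    fix r assume "r \<in> ?\<Omega>"
    then obtain i where i: "i \<in> I" "t \<le> \<bar>F i r - avg ?\<Omega> (F i)\<bar>" using big by blast
    have m: "avg ?\<Omega> (\<lambda>r. - F i r) = - avg ?\<Omega> (F i)" using avg_cmult[of ?\<Omega> "-1" "F i"] by simp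
    have "exp (s * t) \<le> exp (s * \<bar>F i r - avg ?\<Omega> (F i)\<bar>)" using i s by simp
    also have "\<dots> \<le> P 1 i r + P (-1) i r"
      by (cases "F i r - avg ?\<Omega> (F i) \<ge> 0") (auto simp: P_def m abs_if)
    also have "\<dots> \<le> (\<Sum>i\<in>I. P 1 i r + P (-1) i r)"
      using i(1) I by (intro member_le_sum) (auto simp: P_def)
    finally show "exp (s * t) \<le> (\<Sum>i\<in>I. P 1 i r + P (-1) i r)" .
  qed
  also have "\<dots> = (\<Sum>i\<in>I. avg ?\<Omega> (P 1 i) + avg ?\<Omega> (P (-1) i))"
    unfolding avg_sum by (simp add: avg_def sum.distrib add_divide_distrib)
  also have "\<dots> \<le> (\<Sum>i\<in>I. 2 * exp (2 * t\<^sup>2 / N))"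
  proof (rule sum_mono)
    fix i assume "i \<in> I"
    from P[OF this, of 1] P[OF this, of "-1"]
    show "avg ?\<Omega> (P 1 i) + avg ?\<Omega> (P (-1) i) \<le> 2 * exp (2 * t\<^sup>2 / N)" by simp
  qed
  also have "\<dots> = 2 * real (card I) * exp (- (2 * t\<^sup>2 / N)) * exp (s * t)"
  proof -
    have "s * t = 4 * t\<^sup>2 / N" by (simp add: s_def power2_eq_square)
    then show ?thesis by (simp add: exp_add[symmetric])
  qed
  also have "\<dots> < 1 * exp (s * t)" by (intro mult_strict_right_mono small) auto
  finally show False by simp
qed

section \<open>Words and rounding\<close>

definition word_shift :: "nat \<Rightarrow> (nat \<Rightarrow> nat) \<Rightarrow> nat \<Rightarrow> nat" where
  "word_shift p w = (\<lambda>e. (w e + 1) mod p)"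

text \<open>A word assigns a color to each of \<open>M\<close> pieces. The disjunct \<open>M \<le> s\<close> also erases the irrelevant
  values beyond \<open>M\<close>, so that the last sweep is constant.\<close>

definition overwrite :: "nat \<Rightarrow> nat \<Rightarrow> (nat \<Rightarrow> nat) \<Rightarrow> nat \<Rightarrow> nat" where
  "overwrite M s w = (\<lambda>e. if e < s \<or> M \<le> s then 0 else w e)"

definition cuts :: "nat \<Rightarrow> (nat \<Rightarrow> nat) \<Rightarrow> nat set" where
  "cuts M w = {e. Suc e < M \<and> w e \<noteq> w (Suc e)}"

definition disagreement :: "nat \<Rightarrow> (nat \<Rightarrow> nat) \<Rightarrow> (nat \<Rightarrow> nat) \<Rightarrow> nat set" where
  "disagreement M w w' = {e. e < M \<and> w e \<noteq> w' e}"

text \<open>Values are bounded at every piece, even beyond \<open>M\<close>, so that the shift has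
  period \<open>p\<close> on whole words.\<close>

definition good_lists :: "nat \<Rightarrow> nat \<Rightarrow> nat \<Rightarrow> (nat \<Rightarrow> nat) list set" where
  "good_lists M p d = {x. length x = Suc d \<and>
     (\<forall>w\<in>set x. (\<forall>e. w e < p) \<and> card (cuts M w) \<le> d) \<and>
     (\<forall>w\<in>set x. \<forall>w'\<in>set x. card (disagreement M w w') \<le> d)}"

lemma finite_cuts [simp]: "finite (cuts M w)"
  by (rule finite_subset[of _ "{..<M}"]) (auto simp: cuts_def)

lemma finite_disagreement [simp]: "finite (disagreement M w w')"
  by (rule finite_subset[of _ "{..<M}"]) (auto simp: disagreement_def)

lemma funpow_word_shift: "(\<And>e. w e < p) \<Longrightarrow> (word_shift p ^^ g) w = (\<lambda>e. (w e + g) mod p)"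
  by (induction g) (auto simp: word_shift_def mod_Suc_eq)

lemma card_cuts_overwrite: "card (cuts M (overwrite M s w)) \<le> Suc (card (cuts M w))"
proof -
  \<comment> \<open>A new change can only arise at the end of the overwritten prefix. For
    \<open>s = 0\<close> there is none, and inserting \<open>s - 1\<close> is harmless.\<close>
  have "cuts M (overwrite M s w) \<subseteq> insert (s - 1) (cuts M w)"
    by (auto simp: cuts_def overwrite_def split: if_splits)
  then have "card (cuts M (overwrite M s w)) \<le> card (insert (s - 1) (cuts M w))"
    by (rule card_mono[rotated]) simp
  then show ?thesis by (simp add: card_insert_if split: if_splits)
qed

lemma card_disagreement_overwrite:
  assumes "s1 \<in> {s, Suc s}" "s2 \<in> {s, Suc s}"
  shows "card (disagreement M (overwrite M s1 w) (overwrite M s2 w')) \<le> Suc (card (disagreement M w w'))"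
proof -
  have "disagreement M (overwrite M s1 w) (overwrite M s2 w') \<subseteq> insert s (disagreement M w w')"
    using assms by (auto simp: disagreement_def overwrite_def split: if_splits)
  then have "card (disagreement M (overwrite M s1 w) (overwrite M s2 w')) \<le>
      card (insert s (disagreement M w w'))"
    by (rule card_mono[rotated]) simp
  then show ?thesis by (simp add: card_insert_if split: if_splits)
qed

text \<open>The allowances in \<open>good_lists\<close> grow by one per dimension, which is what one
  prism can cost: one new color change and one new disagreement.\<close>

lemma sweep_words:
  assumes "0 < M" "0 < p"
  shows "sweep (word_shift p) p (overwrite M) M (\<lambda>_. 0) (good_lists M p)"
proof
  show "overwrite M 0 v = v" for v using assms by (simp add: overwrite_def)
  show "overwrite M M v = (\<lambda>_. 0)" for v by (simp add: overwrite_def)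
  show "[\<lambda>_. 0] \<in> good_lists M p 0"
    using assms by (simp add: good_lists_def cuts_def disagreement_def)
next
  fix x d assume x: "x \<in> good_lists M p d"
  have cuts: "card (cuts M (word_shift p w)) \<le> card (cuts M w)" for w
    by (rule card_mono[OF finite_cuts]) (auto simp: cuts_def word_shift_def)
  have dis: "card (disagreement M (word_shift p w) (word_shift p w')) \<le> card (disagreement M w w')"
    for w w' by (rule card_mono[OF finite_disagreement]) (auto simp: disagreement_def word_shift_def)
  have "word_shift p w e < p" for w e using assms by (simp add: word_shift_def)
  then show "map (word_shift p) x \<in> good_lists M p d"
    using x by (auto simp: good_lists_def intro!: order_trans[OF cuts] order_trans[OF dis])
  show "length x = Suc d" using x by (simp add: good_lists_def)
  show "(word_shift p ^^ p) v = v" if "v \<in> set x" for v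
    using x that by (subst funpow_word_shift) (auto simp: good_lists_def)
  fix s i assume "s < M" "i \<le> d"
  let ?y = "map (overwrite M (Suc s)) (take (Suc i) x) @ map (overwrite M s) (drop i x)"
  have y: "\<exists>s1\<in>{s, Suc s}. \<exists>v\<in>set x. w = overwrite M s1 v" if "w \<in> set ?y" for w
    using that by (auto dest: in_set_takeD in_set_dropD)
  show "?y \<in> good_lists M p (Suc d)"
    unfolding good_lists_def
  proof (intro CollectI conjI ballI)
    show "length ?y = Suc (Suc d)" using x \<open>i \<le> d\<close> by (simp add: good_lists_def)
  next
    fix w assume "w \<in> set ?y"
    then obtain s1 v where v: "v \<in> set x" "w = overwrite M s1 v" using y by blast
    show "\<forall>e. w e < p" using v x assms by (auto simp: good_lists_def overwrite_def)
    have "card (cuts M v) \<le> d" using v x by (simp add: good_lists_def)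
    with card_cuts_overwrite[of M s1 v] show "card (cuts M w) \<le> Suc d" using v by simp
  next
    fix w w' assume "w \<in> set ?y" "w' \<in> set ?y"
    then obtain s1 v s2 v' where v: "v \<in> set x" "w = overwrite M s1 v" "s1 \<in> {s, Suc s}"
      "v' \<in> set x" "w' = overwrite M s2 v'" "s2 \<in> {s, Suc s}" using y by meson
    have "card (disagreement M v v') \<le> d" using v x by (simp add: good_lists_def)
    with card_disagreement_overwrite[OF v(3,6), of M v v'] v
    show "card (disagreement M w w') \<le> Suc d" by simp
  qed
qed

lemma one_lipschitz_hamming:
  assumes f: "one_lipschitz m f" and "S \<subseteq> {1..m}" "S' \<subseteq> {1..m}"
  shows "\<bar>f S - f S'\<bar> \<le> real (hamming_dist S S')"
  using assms(2)
proof (induction "hamming_dist S S'" arbitrary: S)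
  case 0
  have "finite S" "finite S'" using 0 assms finite_subset by blast+
  then show ?case using 0 by (auto simp: hamming_dist_def)
next
  case (Suc h)
  have fin: "finite S" "finite S'" using Suc assms finite_subset by blast+
  have "(S - S') \<union> (S' - S) \<noteq> {}" using Suc.hyps(2) by (auto simp: hamming_dist_def)
  then obtain a where a: "a \<in> (S - S') \<union> (S' - S)" by blast
  define T where "T = (if a \<in> S then S - {a} else insert a S)"
  have T: "T \<subseteq> {1..m}" using a Suc.prems assms by (auto simp: T_def)
  have "(S - T) \<union> (T - S) = {a}" by (auto simp: T_def)
  then have "hamming_dist S T \<le> 1" by (simp add: hamming_dist_def)
  then have 1: "\<bar>f S - f T\<bar> \<le> 1" using f Suc.prems T unfolding one_lipschitz_def by blast
  have "(T - S') \<union> (S' - T) = ((S - S') \<union> (S' - S)) - {a}" using a by (auto simp: T_def)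
  then have h: "hamming_dist T S' = h"
    using Suc.hyps(2) a fin by (simp add: hamming_dist_def)
  from Suc.hyps(1)[OF h[symmetric] T] 1 show ?case
    using h Suc.hyps(2) by simp
qed

section \<open>Random rounding and expected values\<close>

text \<open>Element \<open>e\<close> consists of the pieces \<open>e * R, \<dots>, e * R + R - 1\<close>, and it receives the color of a
  randomly chosen one of them. As the elements are \<open>1, \<dots>, m\<close>, words have length \<open>Suc m * R\<close> and
  their first block is a dummy.\<close>

definition round_class :: "nat \<Rightarrow> nat \<Rightarrow> (nat \<Rightarrow> nat) \<Rightarrow> (nat \<Rightarrow> nat) \<Rightarrow> nat \<Rightarrow> nat set" where
  "round_class m R w r c = {e \<in> {1..m}. w (e * R + r e) = c}"

definition mean_value ::
  "nat \<Rightarrow> nat \<Rightarrow> (nat set \<Rightarrow> real) \<Rightarrow> (nat \<Rightarrow> nat) \<Rightarrow> nat \<Rightarrow> real" where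
  "mean_value m R f w c = avg ({1..m} \<rightarrow>\<^sub>E {..<R}) (\<lambda>r. f (round_class m R w r c))"

lemma avg_PiE_component:
  assumes "finite A" "a \<in> A" "finite U" "U \<noteq> {}"
  shows "avg (A \<rightarrow>\<^sub>E U) (\<lambda>r. g (r a)) = avg U g"
proof -
  have "avg (insert a (A - {a}) \<rightarrow>\<^sub>E U) (\<lambda>r. g (r a)) = avg ((A - {a}) \<rightarrow>\<^sub>E U) (\<lambda>r. avg U g)"
    using assms by (subst avg_PiE_insert) auto
  also have "\<dots> = avg U g"
    using assms by (intro avg_const finite_PiE) (auto simp: PiE_eq_empty_iff)
  finally show ?thesis using assms by (simp add: insert_absorb)
qed

text \<open>Round both words with the same \<open>r\<close>. The classes differ at most in the
  elements whose chosen piece disagrees, and for each element this has probability at most the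
  number of disagreements divided by \<open>R\<close>.\<close>

lemma mean_value_lipschitz:
  assumes f: "one_lipschitz m f" and R: "0 < R"
  shows "mean_value m R f w c - mean_value m R f w' c
    \<le> real m * real (card (disagreement (Suc m * R) w w')) / real R"
proof -
  let ?\<Omega> = "{1..m} \<rightarrow>\<^sub>E {..<R}"
  let ?D = "\<lambda>e u. of_bool (w (e * R + u) \<noteq> w' (e * R + u)) :: real"
  have "mean_value m R f w c - mean_value m R f w' c \<le> avg ?\<Omega> (\<lambda>r. \<Sum>e\<in>{1..m}. ?D e (r e))"
    unfolding mean_value_def avg_diff[symmetric]
  proof (rule avg_mono)
    fix r
    let ?S = "round_class m R w r c" and ?S' = "round_class m R w' r c"
    have "?S \<subseteq> {1..m}" "?S' \<subseteq> {1..m}" by (auto simp: round_class_def)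
    then have "f ?S - f ?S' \<le> real (hamming_dist ?S ?S')"
      using one_lipschitz_hamming[OF f, of ?S ?S'] by linarith
    also have "hamming_dist ?S ?S' \<le> card {e \<in> {1..m}. w (e * R + r e) \<noteq> w' (e * R + r e)}"
      unfolding hamming_dist_def by (rule card_mono) (auto simp: round_class_def)
    also have "real \<dots> = (\<Sum>e\<in>{1..m}. ?D e (r e))"
      by (simp add: sum_of_bool_eq Int_def)
    finally show "f ?S - f ?S' \<le> (\<Sum>e\<in>{1..m}. ?D e (r e))" by simp
  qed
  also have "\<dots> = (\<Sum>e\<in>{1..m}. avg {..<R} (?D e))"
    unfolding avg_sum using R by (intro sum.cong refl avg_PiE_component) auto
  also have "\<dots> \<le> (\<Sum>e\<in>{1..m}. real (card (disagreement (Suc m * R) w w')) / real R)"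
  proof (rule sum_mono)
    fix e assume e: "e \<in> {1..m}"
    have "(\<lambda>u. e * R + u) ` {u \<in> {..<R}. w (e * R + u) \<noteq> w' (e * R + u)} \<subseteq>
        disagreement (Suc m * R) w w'"
    proof (clarsimp simp: disagreement_def)
      fix u assume "u < R"
      moreover have "e * R \<le> m * R" using e by (intro mult_right_mono) auto
      ultimately show "e * R + u < R + m * R" by linarith
    qed
    then have "card {u \<in> {..<R}. w (e * R + u) \<noteq> w' (e * R + u)} \<le> card (disagreement (Suc m * R) w w')"
      by (rule card_inj_on_le[rotated]) (auto simp: inj_on_def)
    then show "avg {..<R} (?D e) \<le> real (card (disagreement (Suc m * R) w w')) / real R"
      by (simp add: avg_def sum_of_bool_eq Int_def divide_right_mono)
  qed
  also have "\<dots> = real m * real (card (disagreement (Suc m * R) w w')) / real R" by simp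
  finally show ?thesis .
qed

lemma mean_value_word_shift:
  assumes "\<And>e. w e < p" "c < p"
  shows "mean_value m R f (word_shift p w) ((c + 1) mod p) = mean_value m R f w c"
proof -
  have "(w e + 1) mod p = (c + 1) mod p \<longleftrightarrow> w e = c" for e
    using inj_onD[OF mod_shift_inj[of p], of "w e" c] assms by auto
  then show ?thesis by (simp add: mean_value_def round_class_def word_shift_def)
qed

lemma all_color_shift:
  fixes p :: nat
  shows "(\<forall>c<p. P c) \<longleftrightarrow> (\<forall>c<p. P ((c + 1) mod p))"
proof -
  have "(\<lambda>c. (c + 1) mod p) ` {..<p} = {..<p}"
    by (rule endo_inj_surj) (use mod_shift_inj in auto)
  then have "(\<forall>c\<in>{..<p}. P c) \<longleftrightarrow> (\<forall>c\<in>{..<p}. P ((c + 1) mod p))"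
    by (metis (mono_tags, lifting) image_iff)
  then show ?thesis by auto
qed

text \<open>A full group of labels gives nearby words that share an unbalanced \<open>i\<close>
  while each color is maximal in one of them. If color \<open>c\<close> beats \<open>c'\<close> by
  more than \<epsilon> in one word, the word in which \<open>c'\<close> is maximal contradicts the
  Lipschitz bound.\<close>

lemma balanced_word_exists:
  assumes p: "prime p" and n: "0 < n" and f: "\<And>i. i < n \<Longrightarrow> one_lipschitz m (f i)" and \<epsilon>: "0 < \<epsilon>"
  shows "\<exists>R w. 0 < R \<and> (\<forall>e. w e < p) \<and> card (cuts (Suc m * R) w) \<le> n * (p - 1) \<and>
    (\<forall>i<n. \<forall>c<p. \<forall>c'<p. mean_value m R (f i) w c - mean_value m R (f i) w c' \<le> \<epsilon>)"
proof (rule ccontr)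
  assume contra: "\<not> ?thesis"
  have p0: "0 < p" using p by (rule prime_gt_0_nat)
  define N where "N = n * (p - 1)"
  \<comment> \<open>The division is so fine that two Lipschitz errors over \<open>N\<close>
    disagreements stay below \<epsilon>.\<close>
  obtain R :: nat where R: "2 * (real m * real N) / \<epsilon> < real R" using reals_Archimedean2 by blast
  have "0 \<le> 2 * (real m * real N) / \<epsilon>" using \<epsilon> by simp
  with R have R0: "0 < R" by linarith
  define M where "M = Suc m * R"
  define v where "v i = mean_value m R (f i)" for i
  define flat where "flat i w \<longleftrightarrow> (\<forall>c<p. \<forall>c'<p. v i w c - v i w c' \<le> \<epsilon>)" for i w
  define top where "top i w c \<longleftrightarrow> (\<forall>c'<p. v i w c' \<le> v i w c)" for i w c
  define I where "I w = (LEAST i. \<not> flat i w)" for w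
  \<comment> \<open>Ties between maximizing colors are broken by searching upward from the color of
    piece 0, which makes the choice equivariant.\<close>
  define J where "J i w = (w 0 + (LEAST g. top i w ((w 0 + g) mod p))) mod p" for i and w :: "nat \<Rightarrow> nat"
  define lab where "lab w = (I w, J (I w) w)" for w
  have ex: "\<exists>i<n. \<not> flat i w" if "\<And>e. w e < p" "card (cuts M w) \<le> N" for w
    using contra R0 that unfolding flat_def v_def M_def N_def by blast
  have v_shift: "v i (word_shift p w) ((c + 1) mod p) = v i w c" if "\<And>e. w e < p" "c < p" for i w c
    unfolding v_def using that by (rule mean_value_word_shift)
  have flat_shift: "flat i (word_shift p w) \<longleftrightarrow> flat i w" if "\<And>e. w e < p" for i w
  proof -
    have "flat i (word_shift p w) \<longleftrightarrow> (\<forall>c<p. \<forall>c'<p. v i (word_shift p w) ((c + 1) mod p) -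
        v i (word_shift p w) ((c' + 1) mod p) \<le> \<epsilon>)"
      unfolding flat_def by (subst all_color_shift, subst (2) all_color_shift) (rule refl)
    then show ?thesis using v_shift[OF that] by (simp add: flat_def)
  qed
  have top_shift: "top i (word_shift p w) ((c + 1) mod p) \<longleftrightarrow> top i w c"
    if "\<And>e. w e < p" "c < p" for i w c
    unfolding top_def by (subst all_color_shift) (use v_shift[OF that(1)] that(2) in simp)
  have lab_shift: "lab (word_shift p w) = color_shift p (lab w)" if w: "\<And>e. w e < p" for w
  proof -
    have "I (word_shift p w) = I w" unfolding I_def using flat_shift[OF w] by simp
    moreover have "J i (word_shift p w) = (J i w + 1) mod p" for i
    proof -
      have idx: "(word_shift p w 0 + g) mod p = ((w 0 + g) mod p + 1) mod p" for g
        by (simp add: word_shift_def mod_simps ac_simps)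
      have "top i (word_shift p w) ((word_shift p w 0 + g) mod p) \<longleftrightarrow> top i w ((w 0 + g) mod p)" for g
        unfolding idx by (rule top_shift[OF w]) (use p0 in simp)
      then show ?thesis unfolding J_def by (simp only: idx)
    qed
    ultimately show ?thesis by (simp add: lab_def color_shift_def)
  qed
  have J_less: "J i w < p" for i w using p0 by (simp add: J_def)
  have top_J: "top i w (J i w)" if w: "\<And>e. w e < p" for i w
  proof -
    have "Max (v i w ` {..<p}) \<in> v i w ` {..<p}" using p0 by (intro Max_in) auto
    then obtain c where c: "c < p" "v i w c = Max (v i w ` {..<p})" by auto
    then have "top i w c" by (auto simp: top_def)
    moreover have "(w 0 + (c + (p - w 0))) mod p = c" using w[of 0] c(1) by simp
    ultimately have "\<exists>g. top i w ((w 0 + g) mod p)" by metis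
    then show ?thesis unfolding J_def by (rule LeastI_ex)
  qed
  interpret S: sweep "word_shift p" p "overwrite M" M "\<lambda>_. 0" "good_lists M p"
    by (rule sweep_words) (use R0 p0 in \<open>simp_all add: M_def\<close>)
  have "\<exists>d\<le>n * (p - 1). \<exists>x\<in>good_lists M p d. \<exists>i<n. \<forall>j<p. (i, j) \<in> lab ` set x"
  proof (rule S.full_group_exists[OF p])
    show "lab (word_shift p w) = color_shift p (lab w)" if "x \<in> good_lists M p d" "w \<in> set x" for d x w
      using that by (intro lab_shift) (auto simp: good_lists_def)
    show "lab w \<in> {..<n} \<times> {..<p}"
      if "d \<le> n * (p - 1)" "x \<in> good_lists M p d" "w \<in> set x" for d x w
    proof -
      have "\<exists>i<n. \<not> flat i w" using that by (intro ex) (auto simp: good_lists_def N_def)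
      then have "I w < n" unfolding I_def by (meson Least_le le_less_trans)
      then show ?thesis using J_less by (simp add: lab_def)
    qed
  qed
  then obtain d x i where d: "d \<le> N" and x: "x \<in> good_lists M p d" and i: "i < n"
    and full: "\<And>j. j < p \<Longrightarrow> (i, j) \<in> lab ` set x" unfolding N_def by blast
  obtain w0 where w0: "w0 \<in> set x" "lab w0 = (i, 0)" using full[OF p0] by auto
  have "\<exists>i<n. \<not> flat i w0" using x w0 d by (intro ex) (auto simp: good_lists_def)
  then have "\<not> flat (I w0) w0" unfolding I_def using LeastI_ex[of "\<lambda>i. \<not> flat i w0"] by blast
  then obtain c c' where c: "c < p" "c' < p" "v i w0 c - v i w0 c' > \<epsilon>"
    using w0 by (auto simp: flat_def lab_def not_le)
  obtain w1 where w1: "w1 \<in> set x" "lab w1 = (i, c')" using full[OF c(2)] by auto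
  have "top i w1 c'" using top_J[of w1 i] w1 x by (auto simp: lab_def good_lists_def)
  then have t: "v i w1 c \<le> v i w1 c'" using c(1) by (simp add: top_def)
  define q where "q = real m * real N / real R"
  have lip: "v i w b - v i w' b \<le> q" if "w \<in> set x" "w' \<in> set x" for w w' b
  proof -
    have "card (disagreement M w w') \<le> N" using x that d by (fastforce simp: good_lists_def)
    then have "real m * real (card (disagreement M w w')) / real R \<le> q"
      unfolding q_def by (intro divide_right_mono mult_left_mono) auto
    then show ?thesis
      using mean_value_lipschitz[OF f[OF i] R0, of w b w'] unfolding v_def M_def by linarith
  qed
  have "\<epsilon> < 2 * q"
    using lip[OF w0(1) w1(1), of c] lip[OF w1(1) w0(1), of c'] t c(3) by linarith
  moreover have "2 * q < \<epsilon>" using R \<epsilon> R0 by (simp add: q_def field_simps)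
  ultimately show False by simp
qed

text \<open>An element with pieces of different colors has a color change inside its block, and
  blocks are disjoint.\<close>

lemma card_cut_elements:
  assumes "0 < R"
  shows "card {a \<in> {1..m}. \<exists>u<R. w (a * R + u) \<noteq> w (a * R)} \<le> card (cuts (Suc m * R) w)"
proof -
  have "{a \<in> {1..m}. \<exists>u<R. w (a * R + u) \<noteq> w (a * R)} \<subseteq> (\<lambda>e. e div R) ` cuts (Suc m * R) w"
  proof
    fix a assume "a \<in> {a \<in> {1..m}. \<exists>u<R. w (a * R + u) \<noteq> w (a * R)}"
    then obtain u where a: "a \<le> m" "u < R" "w (a * R + u) \<noteq> w (a * R)" by auto
    have "\<exists>u. Suc u < R \<and> w (a * R + u) \<noteq> w (a * R + Suc u)"
    proof (rule ccontr)
      assume no: "\<not> ?thesis"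
      have "u < R \<Longrightarrow> w (a * R + u) = w (a * R)" for u
      proof (induction u)
        case (Suc u)
        then show ?case using no by (metis Suc_lessD)
      qed simp
      with a show False by blast
    qed
    then obtain u where u: "Suc u < R" "w (a * R + u) \<noteq> w (a * R + Suc u)" by blast
    have "a * R \<le> m * R" using a by (intro mult_right_mono) auto
    then have "Suc (a * R + u) < Suc m * R" using u(1) unfolding mult_Suc by linarith
    then have "a * R + u \<in> cuts (Suc m * R) w" using u(2) by (simp add: cuts_def)
    moreover have "(a * R + u) div R = a" using u by simp
    ultimately show "a \<in> (\<lambda>e. e div R) ` cuts (Suc m * R) w" by (metis imageI)
  qed
  then have "card {a \<in> {1..m}. \<exists>u<R. w (a * R + u) \<noteq> w (a * R)} \<le>
      card ((\<lambda>e. e div R) ` cuts (Suc m * R) w)"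
    by (rule card_mono[rotated]) simp
  also have "\<dots> \<le> card (cuts (Suc m * R) w)" by (rule card_image_le) simp
  finally show ?thesis .
qed

text \<open>Only elements whose blocks contain a color change are random. Their differences are
  bounded by 1 and all others by 0, so the sum of squares is at most \<open>N\<close>, independently
  of \<open>m\<close>.\<close>

lemma rounding:
  assumes f: "\<And>i. i < n \<Longrightarrow> one_lipschitz m (f i)" and R: "0 < R"
    and N: "card (cuts (Suc m * R) w) \<le> N" "0 < N" and t: "0 < t"
    and small: "2 * (real n * real p) * exp (- (2 * t\<^sup>2 / real N)) < 1"
  shows "\<exists>r. \<forall>i<n. \<forall>c<p. \<bar>f i (round_class m R w r c) - mean_value m R (f i) w c\<bar> < t"
proof -
  define B where "B = {a \<in> {1..m}. \<exists>u<R. w (a * R + u) \<noteq> w (a * R)}"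
  define F where "F = (\<lambda>(i, c) r. f i (round_class m R w r c))"
  have "\<exists>r\<in>{1..m} \<rightarrow>\<^sub>E {..<R}. \<forall>ic\<in>{..<n} \<times> {..<p}. \<bar>F ic r - avg ({1..m} \<rightarrow>\<^sub>E {..<R}) (F ic)\<bar> < t"
  proof (rule mcdiarmid_union[where c = "\<lambda>a. of_bool (a \<in> B)" and N = "real N"])
    show "(\<Sum>a\<in>{1..m}. (of_bool (a \<in> B))\<^sup>2) \<le> real N"
    proof -
      have "B \<subseteq> {1..m}" by (auto simp: B_def)
      then have "(\<Sum>a\<in>{1..m}. (of_bool (a \<in> B) :: real)\<^sup>2) = real (card B)"
        by (simp add: of_bool_def if_distrib[of "\<lambda>x. x\<^sup>2"] sum.If_cases Int_absorb1 cong: if_cong)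
      also have "card B \<le> N" using card_cut_elements[OF R] N(1) unfolding B_def by (rule order_trans)
      finally show ?thesis by simp
    qed
    fix ic r a u v
    assume *: "ic \<in> {..<n} \<times> {..<p}" "a \<in> {1..m}" "u \<in> {..<R}" "v \<in> {..<R}"
    obtain i c where ic: "ic = (i, c)" "i < n" using * by auto
    let ?S = "round_class m R w (r(a := u)) c" and ?S' = "round_class m R w (r(a := v)) c"
    show "\<bar>F ic (r(a := u)) - F ic (r(a := v))\<bar> \<le> of_bool (a \<in> B)"
    proof (cases "a \<in> B")
      case True
      have "(?S - ?S') \<union> (?S' - ?S) \<subseteq> {a}" by (auto simp: round_class_def split: if_splits)
      then have "hamming_dist ?S ?S' \<le> card {a}"
        unfolding hamming_dist_def by (rule card_mono[rotated]) simp
      moreover have "?S \<subseteq> {1..m}" "?S' \<subseteq> {1..m}" by (auto simp: round_class_def)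
      ultimately have "\<bar>f i ?S - f i ?S'\<bar> \<le> 1"
        using f[OF ic(2)] by (simp add: one_lipschitz_def)
      then show ?thesis using True by (simp add: F_def ic)
    next
      case False
      then have "w (a * R + u) = w (a * R + v)" using * by (auto simp: B_def)
      then have "?S = ?S'" by (auto simp: round_class_def)
      then show ?thesis by (simp add: F_def ic)
    qed
  qed (use R N t small in \<open>auto simp: lessThan_empty_iff\<close>)
  then show ?thesis by (auto simp: F_def mean_value_def)
qed

section \<open>Choice of the constants and assembly\<close>

theorem theorem8:
  fixes k m n :: nat and f :: "nat \<Rightarrow> nat set \<Rightarrow> real"
  assumes "prime k" and "m \<ge> 1" and "n \<ge> 1"
    and "\<And>i. i \<in> {1..n} \<Longrightarrow> one_lipschitz m (f i)"
  shows "disc m n f k < sqrt (2 * real n * (real k - 1) * (1 + ln (real n * real k)))"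
proof -
  define N where "N = n * (k - 1)"
  define D where "D = sqrt (2 * real n * (real k - 1) * (1 + ln (real n * real k)))"
  have k: "k \<ge> 2" using assms(1) by (rule prime_ge_2_nat)
  have N: "0 < N" "real N = real n * (real k - 1)" using k assms by (auto simp: N_def of_nat_diff)
  have nk: "1 \<le> real n * real k" using k assms(3) by (metis mult_le_mono mult_1 of_nat_1 of_nat_le_iff of_nat_mult one_le_numeral order_trans)
  \<comment> \<open>At deviation \<open>t0\<close> the union bound equals exactly 1.\<close>
  define t0 where "t0 = sqrt (real N * ln (2 * (real n * real k)) / 2)"
  have "2 * t0 = sqrt (4 * (real N * ln (2 * (real n * real k)) / 2))"
    unfolding t0_def real_sqrt_mult[of 4] by simp
  also have "\<dots> < D"
    unfolding D_def
  proof (rule real_sqrt_less_mono)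
    have "ln (2 * (real n * real k)) < 1 + ln (real n * real k)"
      using nk ln_2_less_1 by (subst ln_mult) auto
    then have "2 * real N * ln (2 * (real n * real k)) < 2 * real N * (1 + ln (real n * real k))"
      using N by (intro mult_strict_left_mono) auto
    then show "4 * (real N * ln (2 * (real n * real k)) / 2) <
        2 * real n * (real k - 1) * (1 + ln (real n * real k))"
      by (simp add: N(2) mult.assoc)
  qed
  \<comment> \<open>Exceeding \<open>t0\<close> makes the union bound strict; staying below
    \<open>D / 2\<close> leaves the slack \<open>D - 2 * t\<close> for the imbalance of the
    word.\<close>
  finally obtain t where t: "t0 < t" "t < D / 2" using dense[of t0 "D / 2"] by auto
  have ln0: "0 \<le> ln (2 * (real n * real k))" using nk by (intro ln_ge_zero) simp
  have t0: "0 \<le> t0" unfolding t0_def using ln0 by simp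
  have small: "2 * (real n * real k) * exp (- (2 * t\<^sup>2 / real N)) < 1"
  proof -
    have "t0\<^sup>2 < t\<^sup>2" using t t0 by (intro power_strict_mono) auto
    then have "real N * ln (2 * (real n * real k)) / 2 < t\<^sup>2" using ln0 by (simp add: t0_def)
    then have "ln (2 * (real n * real k)) < 2 * t\<^sup>2 / real N" using N(1) by (simp add: field_simps)
    then have "2 * (real n * real k) < exp (2 * t\<^sup>2 / real N)"
      using nk by (metis exp_less_mono exp_ln mult_pos_pos less_le_trans zero_less_numeral zero_less_one)
    then show ?thesis by (simp add: exp_minus field_simps)
  qed
  define g where "g i = f (Suc i)" for i
  have g: "one_lipschitz m (g i)" if "i < n" for i using assms(4)[of "Suc i"] that by (simp add: g_def)
  have "0 < n" "0 < D - 2 * t" "0 < t" using assms(3) t t0 by auto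
  obtain R w where R: "0 < R" and w: "\<And>e. w e < k" and cuts: "card (cuts (Suc m * R) w) \<le> N"
    and flat: "\<And>i c c'. i < n \<Longrightarrow> c < k \<Longrightarrow> c' < k \<Longrightarrow>
      mean_value m R (g i) w c - mean_value m R (g i) w c' \<le> D - 2 * t"
    using balanced_word_exists[OF assms(1) \<open>0 < n\<close>, of m g "D - 2 * t"] g \<open>0 < D - 2 * t\<close>
    unfolding N_def by blast
  obtain r where r: "\<And>i c. i < n \<Longrightarrow> c < k \<Longrightarrow>
      \<bar>g i (round_class m R w r c) - mean_value m R (g i) w c\<bar> < t"
    using rounding[of n m g, OF g R cuts N(1) \<open>0 < t\<close> small] by blast
  \<comment> \<open>Words use the colors \<open>0\<close> to \<open>k - 1\<close>, colorings the
    colors \<open>1\<close> to \<open>k\<close>.\<close>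
  define col where "col = (\<lambda>e\<in>{1..m}. Suc (w (e * R + r e)))"
  have col: "col \<in> colorings m k" using w by (auto simp: col_def colorings_def Suc_le_eq)
  have cls: "color_class m col (Suc c) = round_class m R w r c" for c
    by (auto simp: color_class_def round_class_def col_def)
  have diff: "\<bar>f i (color_class m col j) - f i (color_class m col l)\<bar> < D"
    if "i \<in> {1..n}" "j \<in> {1..k}" "l \<in> {1..k}" for i j l
  proof -
    define i' j' l' where "i' = i - 1" and "j' = j - 1" and "l' = l - 1"
    have eq: "i = Suc i'" "j = Suc j'" "l = Suc l'" and lt: "i' < n" "j' < k" "l' < k"
      using that by (auto simp: i'_def j'_def l'_def)
    \<comment> \<open>Two rounding errors below \<open>t\<close> and an imbalance of at most
      \<open>D - 2 * t\<close> add up to less than \<open>D\<close>.\<close>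
    show ?thesis
      using r[OF lt(1,2)] r[OF lt(1,3)] flat[OF lt] flat[OF lt(1,3,2)]
      unfolding eq cls g_def by linarith
  qed
  have "coloring_disc m n f k col < D"
    unfolding coloring_disc_def using assms(3) k diff by (subst Max_less_iff; fastforce)+
  moreover have "disc m n f k \<le> coloring_disc m n f k col"
    unfolding disc_def using col by (intro Min_le) (auto simp: colorings_def intro!: finite_PiE)
  ultimately show ?thesis by (simp add: D_def)
qed

end
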